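(* Let $(X,\mathcal S(X),\mu,T)$ be a conservative and ergodic nonsingular dynamical system. Then $T$ is W-measurably sensitive if and only if no nonsingular dynamical system $(X',\mathcal S(X'),\mu',T')$ measurably isomorphic (mod $0$) to $(X,\mathcal S(X),\mu,T)$ admits a $\mu'$-compatible metric that is $1$-Lipschitz with respect to $T'$.
   Context: A nonsingular dynamical system is a quadruple $(X,\mathcal S(X),\mu,T)$ (also written $(X,\mu,T)$) where $(X,\mathcal S(X))$ is a standard Borel space, $\mu$ is a nonzero $\sigma$-finite nonatomic measure on $\mathcal S(X)$, and $T:X\to X$ is measurable with $\mu(A)=0$ if and only if $\mu(T^{-1}(A))=0$ for all $A\in\mathcal S(X)$. $T$ is conservative and ergodic if and only if for every measurable $A$ with $T^{-1}(A)\subset A$ one has $\mu(A)=0$ or $\mu(A^c)=0$. All metrics $d:X\times X\to\mathbb R$ are assumed Borel measurable and bounded by $1$. Such a metric $d$ is $\mu$-compatible if every ball $\{y: d(x,y)<\varepsilon\}$ ($x\in X$, $\varepsilon>0$) has positive $\mu$-measure. A metric $d$ is $1$-Lipschitz with respect to $T$ if $d(Tx,Ty)\le d(x,y)$ for all $x,y$. For a $\mu$-compatible metric $d$, the system is W-measurably sensitive with respect to $d$ if there is $\delta>0$ such that for every $x\in X$, $\limsup_{n\to\infty} d(T^nx,T^ny)>\delta$ for $\mu$-almost every $y\in X$. The system is W-measurably sensitive if this holds for every $\mu$-compatible metric $d$ on $X$. Isomorphism mod $0$ of $(X,\mu,T)$ and $(X',\mu',T')$: there are Borel sets $U\subset X$,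 $U'\subset X'$ with $\mu(X\setminus U)=\mu'(X'\setminus U')=0$, $T(U)\subset U$, $T'(U')\subset U'$, and a measure-preserving (bimeasurable) bijection $\phi:U\to U'$ with $\phi\circ T=T'\circ\phi$ on $U$. *)

theory Defs
  imports "HOL-Analysis.Analysis"
begin

text \<open>
  The measure \<open>M\<close> enters only through \<open>space M\<close> and \<open>sets M\<close>. The carrier may be a proper
  subset of the type, hence the topology is a value rather than a \<open>polish_space\<close> instance.
\<close>

definition standard_Borel :: "'a measure \<Rightarrow> bool" where
  "standard_Borel M \<longleftrightarrow>
     (\<exists>S. completely_metrizable_space S \<and> separable_space S \<and> topspace S = space M \<and>
          sets M = sigma_sets (space M) {U. openin S U})"

definition nonatomic :: "'a measure \<Rightarrow> bool" where
  "nonatomic M \<longleftrightarrow>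
     (\<forall>A\<in>sets M. 0 < emeasure M A \<longrightarrow>
        (\<exists>B\<in>sets M. B \<subseteq> A \<and> 0 < emeasure M B \<and> emeasure M B < emeasure M A))"

locale nonsingular_system = sigma_finite_measure M
  for M :: "'a measure" and T :: "'a \<Rightarrow> 'a" +
  assumes standard_Borel: "standard_Borel M"
    and nonzero: "emeasure M (space M) \<noteq> 0"
    and nonatomic: "nonatomic M"
    and measurable_T: "T \<in> M \<rightarrow>\<^sub>M M"
    and nonsingular:
      "\<And>A. A \<in> sets M \<Longrightarrow> emeasure M A = 0 \<longleftrightarrow> emeasure M (T -` A \<inter> space M) = 0"

definition conservative_ergodic :: "'a measure \<Rightarrow> ('a \<Rightarrow> 'a) \<Rightarrow> bool" where
  "conservative_ergodic M T \<longleftrightarrow>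
     (\<forall>A\<in>sets M. T -` A \<inter> space M \<subseteq> A \<longrightarrow>
        emeasure M A = 0 \<or> emeasure M (space M - A) = 0)"

text \<open>
  \<open>Metric_space\<close> also demands nonnegativity and symmetry off the carrier. This is no
  restriction: every metric on \<open>space M\<close> extends by \<open>0\<close>, and the notions below
  depend only on its values on \<open>space M\<close>.
\<close>

definition Borel_metric :: "'a measure \<Rightarrow> ('a \<Rightarrow> 'a \<Rightarrow> real) \<Rightarrow> bool" where
  "Borel_metric M d \<longleftrightarrow>
     Metric_space (space M) d \<and>
     (\<lambda>(x, y). d x y) \<in> borel_measurable (M \<Otimes>\<^sub>M M) \<and>
     (\<forall>x\<in>space M. \<forall>y\<in>space M. d x y \<le> 1)"

definition compatible_metric :: "'a measure \<Rightarrow> ('a \<Rightarrow> 'a \<Rightarrow> real) \<Rightarrow> bool" where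
  "compatible_metric M d \<longleftrightarrow>
     Borel_metric M d \<and>
     (\<forall>x\<in>space M. \<forall>\<epsilon>>0. 0 < emeasure M (Metric_space.mball (space M) d x \<epsilon>))"

definition one_Lipschitz_wrt ::
  "'a measure \<Rightarrow> ('a \<Rightarrow> 'a) \<Rightarrow> ('a \<Rightarrow> 'a \<Rightarrow> real) \<Rightarrow> bool" where
  "one_Lipschitz_wrt M T d \<longleftrightarrow>
     (\<forall>x\<in>space M. \<forall>y\<in>space M. d (T x) (T y) \<le> d x y)"

definition W_sensitive_wrt ::
  "'a measure \<Rightarrow> ('a \<Rightarrow> 'a) \<Rightarrow> ('a \<Rightarrow> 'a \<Rightarrow> real) \<Rightarrow> bool" where
  "W_sensitive_wrt M T d \<longleftrightarrow>
     (\<exists>\<delta>>0. \<forall>x\<in>space M. AE y in M.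
        limsup (\<lambda>n. ereal (d ((T ^^ n) x) ((T ^^ n) y))) > ereal \<delta>)"

definition W_measurably_sensitive :: "'a measure \<Rightarrow> ('a \<Rightarrow> 'a) \<Rightarrow> bool" where
  "W_measurably_sensitive M T \<longleftrightarrow>
     (\<forall>d. compatible_metric M d \<longrightarrow> W_sensitive_wrt M T d)"

definition isomorphic_mod0 ::
  "'a measure \<Rightarrow> ('a \<Rightarrow> 'a) \<Rightarrow> 'b measure \<Rightarrow> ('b \<Rightarrow> 'b) \<Rightarrow> bool" where
  "isomorphic_mod0 M T M' T' \<longleftrightarrow>
     (\<exists>U\<in>sets M. \<exists>U'\<in>sets M'. \<exists>\<phi>.
        emeasure M (space M - U) = 0 \<and> emeasure M' (space M' - U') = 0 \<and>
        T ` U \<subseteq> U \<and> T' ` U' \<subseteq> U' \<and>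
        bij_betw \<phi> U U' \<and>
        \<phi> \<in> restrict_space M U \<rightarrow>\<^sub>M restrict_space M' U' \<and>
        inv_into U \<phi> \<in> restrict_space M' U' \<rightarrow>\<^sub>M restrict_space M U \<and>
        distr (restrict_space M U) (restrict_space M' U') \<phi> = restrict_space M' U' \<and>
        (\<forall>x\<in>U. \<phi> (T x) = T' (\<phi> x)))"

text \<open>
  HOL cannot quantify over types inside a formula, so the type \<open>'b\<close> housing the
  isomorphic system is an explicit parameter.
\<close>

definition has_isomorphic_Lipschitz_system ::
  "'b itself \<Rightarrow> 'a measure \<Rightarrow> ('a \<Rightarrow> 'a) \<Rightarrow> bool" where
  "has_isomorphic_Lipschitz_system _ M T \<longleftrightarrow>
     (\<exists>(M' :: 'b measure) T'. nonsingular_system M' T' \<and> isomorphic_mod0 M T M' T' \<and>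
        (\<exists>d. compatible_metric M' d \<and> one_Lipschitz_wrt M' T' d))"

text \<open>
  ``No system \<open>(M', T')\<close>, on whatever type'' is therefore stated as the absence of such a system
  both on \<open>'a\<close> itself (with arbitrary carrier) and on an arbitrary type \<open>'b\<close>.
  Keeping \<open>'b\<close> alone would make the equivalence false for types too small to carry an
  isomorphic system; keeping \<open>'a\<close> alone would leave other types unmentioned. With both, the
  schematic type \<open>'b\<close> gives the claim with the quantifier over all types: sensitivity excludes
  such systems on every type, and if they are excluded on every type then sensitivity follows.
\<close>

end

theory Submission
  imports Defs
begin

text \<open>
  If a compatible metric \<open>d\<close> witnesses the failure of sensitivity, put
  \<open>D x y = sup\<^sub>n d (T\<^sup>n x) (T\<^sup>n y)\<close>, which is 1-Lipschitz. Failure of sensitivity yields for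
  every \<open>\<epsilon>\<close> a point with \<open>D\<close>-ball of radius \<open>\<epsilon>\<close> of positive measure. The set of such points is
  mapped into itself by \<open>T\<close>, hence conull by ergodicity, and \<open>D\<close> is compatible on the intersection
  of these sets over all \<open>\<epsilon>\<close>. This intersection is a Borel set, thus standard Borel.

  Conversely, a compatible 1-Lipschitz metric on an isomorphic system pulls back to a metric for which
  nearby points stay nearby, so sensitivity fails. To define it on the null set missed by
  the isomorphism, that null set is first injected into a null Cantor set inside the domain.
\<close>

subsection \<open>Cantor space and second countability\<close>

text \<open>Both directions are shaped by the demand that balls around every point, not just almost
  every point, have positive measure. Points where a metric violates it have to leave the space;
  this is where isomorphism mod 0 enters, and why Borel subsets must be shown to be standard Borel.

  Conversely, the null set missed by the isomorphism cannot be dropped, since sensitivity is tested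
  on the given carrier. Nor can its points be isolated: singletons are null, so a small ball around
  an isolated point would be null. They have to be placed among other points, measurably and without
  collisions. That null set may be uncountable, hence the need for an uncountable null set to
  receive it; nonatomicity provides one.

  In \<open>D\<close> the supremum over the whole orbit replaces the limsup: the term at time 0
  keeps distinct points apart. Failure of sensitivity controls only the limsup, but passing to
  \<open>T\<^sup>m x\<close> and \<open>T\<^sup>m y\<close> for large \<open>m\<close> turns a bound
  on the tail into a bound on the supremum, and nonsingularity pulls null sets back along
  \<open>T\<^sup>m\<close>.\<close>

abbreviation cantor_space :: "(nat \<Rightarrow> bool) topology" where
  "cantor_space \<equiv> product_topology (\<lambda>_. discrete_topology UNIV) UNIV"

definition cylinder :: "bool list \<Rightarrow> (nat \<Rightarrow> bool) set" where
  "cylinder s = {z. \<forall>i<length s. z i = s ! i}"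

lemma openin_cantor_coordinate: "openin cantor_space {z. P (z n)}"
proof -
  have "continuous_map cantor_space (discrete_topology UNIV) (\<lambda>z. z n)"
    by (rule continuous_map_product_projection) simp
  then have "openin cantor_space {z \<in> topspace cantor_space. z n \<in> {b. P b}}"
    by (rule openin_continuous_map_preimage) simp
  then show ?thesis by simp
qed

lemma openin_cylinder: "openin cantor_space (cylinder s)"
proof (cases "s = []")
  case True
  then show ?thesis
    using openin_topspace[of cantor_space] by (simp add: cylinder_def)
next
  case False
  have "openin cantor_space (\<Inter>i\<in>{..<length s}. {z. z i = s ! i})"
    using False by (intro openin_INT2 openin_cantor_coordinate) auto
  moreover have "cylinder s = (\<Inter>i\<in>{..<length s}. {z. z i = s ! i})"
    by (auto simp: cylinder_def)
  ultimately show ?thesis by simp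
qed

text \<open>A basic open set of the product constrains only finitely many coordinates, so fixing a
  long enough prefix of \<open>z\<close> suffices.\<close>

lemma cylinder_base:
  assumes "openin cantor_space W" and "z \<in> W"
  obtains s where "z \<in> cylinder s" and "cylinder s \<subseteq> W"
proof -
  from assms obtain X where X: "z \<in> Pi\<^sub>E UNIV X" "Pi\<^sub>E UNIV X \<subseteq> W"
      "finite {i. X i \<noteq> UNIV}"
    using product_topology_open_contains_basis[of "\<lambda>_. discrete_topology UNIV" UNIV W z]
    by (auto simp: PiE_UNIV_domain)
  obtain n where n: "{i. X i \<noteq> UNIV} \<subseteq> {..<n}"
    using X(3) finite_nat_iff_bounded by auto
  have "cylinder (map z [0..<n]) \<subseteq> Pi\<^sub>E UNIV X"
  proof
    fix y assume "y \<in> cylinder (map z [0..<n])"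
    then have y: "\<And>i. i < n \<Longrightarrow> y i = z i" by (auto simp: cylinder_def)
    have "y i \<in> X i" for i
    proof (cases "i < n")
      case True
      then show ?thesis using X(1) y by auto
    next
      case False
      then have "X i = UNIV" using n by auto
      then show ?thesis by simp
    qed
    then show "y \<in> Pi\<^sub>E UNIV X" by auto
  qed
  with X(2) show thesis
    by (intro that[of "map z [0..<n]"]) (auto simp: cylinder_def)
qed

lemma completely_metrizable_cantor_space: "completely_metrizable_space cantor_space"
  by (simp add: completely_metrizable_space_product_topology
      completely_metrizable_space_discrete_topology)

lemma gdelta_in_continuous_map_preimage:
  assumes "continuous_map X Y f" and "gdelta_in Y G"
  shows "gdelta_in X {x \<in> topspace X. f x \<in> G}"
proof -
  obtain C where C: "\<And>n::nat. openin Y (C n)" "\<And>n. C (Suc n) \<subseteq> C n" "\<Inter>(range C) = G"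
    using assms(2) by (auto simp: gdelta_in_descending)
  have "\<forall>n. openin X {x \<in> topspace X. f x \<in> C n}"
    using openin_continuous_map_preimage[OF assms(1) C(1)] by simp
  moreover have "\<Inter>(range (\<lambda>n. {x \<in> topspace X. f x \<in> C n})) = {x \<in> topspace X. f x \<in> G}"
    using C(3) by auto
  ultimately show ?thesis
    unfolding gdelta_in_descending using C(2)
    by (intro exI[of _ "\<lambda>n. {x \<in> topspace X. f x \<in> C n}"]) auto
qed

lemma separable_metrizable_imp_second_countable:
  assumes "metrizable_space X" and "separable_space X"
  shows "second_countable X"
proof -
  obtain M d where Md: "Metric_space M d" and X: "X = Metric_space.mtopology M d"
    using assms(1) by (auto simp: metrizable_space_def)
  interpret Metric_space M d by fact
  obtain C where C: "countable C" "C \<subseteq> M" "mtopology closure_of C = M"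
    using assms(2) by (auto simp: separable_space_def X)
  define \<B> where "\<B> = (\<lambda>(c, k). mball c (1 / real (Suc k))) ` (C \<times> UNIV)"
  show ?thesis
    unfolding second_countable_def
  proof (intro exI conjI ballI allI impI)
    show "countable \<B>" unfolding \<B>_def using C(1) by auto
    show "openin X V" if "V \<in> \<B>" for V
      using that by (auto simp: \<B>_def X)
    fix U x assume U: "openin X U \<and> x \<in> U"
    then have xM: "x \<in> M" using openin_subset X by fastforce
    from U obtain r where r: "r > 0" "mball x r \<subseteq> U"
      unfolding X openin_mtopology by blast
    obtain k where k: "1 / real (Suc k) < r / 2"
      using r(1) reals_Archimedean[of "r/2"] by (auto simp: inverse_eq_divide)
    have "x \<in> mtopology closure_of C" using C(3) xM by simp
    then obtain c where c: "c \<in> C" "c \<in> mball x (1 / real (Suc k))"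
      unfolding metric_closure_of using mball_def
      by (smt (verit, best) divide_pos_pos mem_Collect_eq of_nat_0_less_iff zero_less_Suc zero_less_one)
    show "\<exists>V\<in>\<B>. x \<in> V \<and> V \<subseteq> U"
    proof (intro bexI[of _ "mball c (1 / real (Suc k))"] conjI)
      show "x \<in> mball c (1 / real (Suc k))" using c(2) by (auto simp: commute)
      show "mball c (1 / real (Suc k)) \<subseteq> U"
      proof
        fix y assume y: "y \<in> mball c (1 / real (Suc k))"
        have "d x y \<le> d x c + d c y" using xM c y by (intro triangle) auto
        also have "\<dots> < r" using c(2) y k by auto
        finally show "y \<in> U" using y r(2) xM by auto
      qed
      show "mball c (1 / real (Suc k)) \<in> \<B>" using c(1) by (auto simp: \<B>_def)
    qed
  qed
qed

lemma second_countableE: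
  assumes "second_countable X"
  obtains \<B> where "countable \<B>" "\<And>V. V \<in> \<B> \<Longrightarrow> openin X V"
    "\<And>U x. openin X U \<Longrightarrow> x \<in> U \<Longrightarrow> \<exists>V\<in>\<B>. x \<in> V \<and> V \<subseteq> U"
proof -
  obtain \<B> where "countable \<B> \<and> (\<forall>V\<in>\<B>. openin X V) \<and>
      (\<forall>U x. openin X U \<and> x \<in> U \<longrightarrow> (\<exists>V\<in>\<B>. x \<in> V \<and> V \<subseteq> U))"
    using assms unfolding second_countable_def by (rule exE)
  then show thesis by (intro that[of \<B>]) simp_all
qed

subsection \<open>Borel subsets of standard Borel spaces\<close>

text \<open>
  A Borel code of \<open>A\<close> is recorded as a function \<open>h\<close> into Cantor space whose bit \<open>0\<close> is the
  indicator of \<open>A\<close> and whose other bits are the indicators of the sets occurring in the construction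
  of \<open>A\<close>. Each construction step is a \<open>G\<^sub>\<delta>\<close> condition on these bits, so that the graph
  of \<open>h\<close> is \<open>G\<^sub>\<delta>\<close>. The topology of the graph, transported to the carrier, is then a finer
  Polish topology that makes \<open>A\<close> clopen.
\<close>

definition graph_coded :: "'a topology \<Rightarrow> 'a set \<Rightarrow> bool" where
  "graph_coded S A \<longleftrightarrow> (\<exists>h :: 'a \<Rightarrow> nat \<Rightarrow> bool.
     (\<forall>n. {x \<in> topspace S. h x n} \<in> sigma_sets (topspace S) {U. openin S U}) \<and>
     (\<forall>x\<in>topspace S. h x 0 \<longleftrightarrow> x \<in> A) \<and>
     gdelta_in (prod_topology S cantor_space) ((\<lambda>x. (x, h x)) ` topspace S))"

context
  fixes S :: "'a topology"
  assumes cm: "completely_metrizable_space S"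
begin

lemma metrizable_prod_cantor: "completely_metrizable_space (prod_topology S cantor_space)"
  using cm by (simp add: completely_metrizable_space_prod_topology completely_metrizable_cantor_space)

lemma openin_coordinate: "openin (prod_topology S cantor_space) {p \<in> topspace S \<times> UNIV. P (snd p n)}"
  using openin_continuous_map_preimage[OF continuous_map_snd openin_cantor_coordinate, of S P n]
  by simp

lemma closedin_coordinate: "closedin (prod_topology S cantor_space) {p \<in> topspace S \<times> UNIV. P (snd p n)}"
  using closedin_continuous_map_preimage[OF continuous_map_snd, of cantor_space "{z. P (z n)}" S]
    openin_cantor_coordinate[of "\<lambda>b. \<not> P b" n]
  by (simp add: closedin_def Collect_neg_eq Compl_eq_Diff_UNIV[symmetric])

lemma closedin_imp_gdelta: "closedin (prod_topology S cantor_space) F \<Longrightarrow>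
    gdelta_in (prod_topology S cantor_space) F"
  by (intro closed_imp_gdelta_in completely_metrizable_imp_metrizable_space metrizable_prod_cantor)

text \<open>The code repeats the indicator of \<open>U\<close> in every bit. Each bit is correct on
  the union of an open-and-closed-condition part over \<open>U\<close> and a closed part over its
  complement, and the graph is the countable intersection of these conditions.\<close>

lemma graph_coded_openin:
  assumes U: "openin S U"
  shows "graph_coded S U"
  unfolding graph_coded_def
proof (intro exI conjI allI)
  let ?h = "\<lambda>x (n::nat). x \<in> U"
  let ?P = "prod_topology S cantor_space"
  have US: "U \<subseteq> topspace S" using U by (rule openin_subset)
  then show "{x \<in> topspace S. x \<in> U} \<in> sigma_sets (topspace S) {U. openin S U}" for n :: nat
    using U by (auto simp: Int_absorb1 Collect_conj_eq)
  have op: "openin ?P {p \<in> topspace ?P. fst p \<in> U}"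
    by (rule openin_continuous_map_preimage[OF continuous_map_fst U])
  have cl: "closedin ?P {p \<in> topspace ?P. fst p \<in> topspace S - U}"
    by (rule closedin_continuous_map_preimage[OF continuous_map_fst]) (use U in auto)
  have g: "gdelta_in ?P (({p \<in> topspace ?P. fst p \<in> U} \<inter> {p \<in> topspace S \<times> UNIV. snd p n})
     \<union> ({p \<in> topspace ?P. fst p \<in> topspace S - U} \<inter> {p \<in> topspace S \<times> UNIV. \<not> snd p n}))" for n
    by (intro gdelta_in_Un gdelta_in_Int open_imp_gdelta_in[OF op] closedin_imp_gdelta[OF cl]
        closedin_imp_gdelta[OF closedin_coordinate])
  have "(\<lambda>x. (x, ?h x)) ` topspace S = (\<Inter>n. (({p \<in> topspace ?P. fst p \<in> U} \<inter> {p \<in> topspace S \<times> UNIV. snd p n})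
     \<union> ({p \<in> topspace ?P. fst p \<in> topspace S - U} \<inter> {p \<in> topspace S \<times> UNIV. \<not> snd p n})))"
    by (auto simp: image_iff fun_eq_iff)
  then show "gdelta_in ?P ((\<lambda>x. (x, ?h x)) ` topspace S)"
    using g by (auto intro!: gdelta_in_Inter)
qed auto

text \<open>Complement and union are taken in one step because this keeps the complexity down:
  membership in the union is an open condition on the bits of the given codes and non-membership a
  closed one, so both are \<open>G\<^sub>\<delta>\<close>.\<close>

lemma graph_coded_Union_compl:
  fixes A :: "nat \<Rightarrow> 'a set"
  assumes A: "\<And>i. graph_coded S (A i)"
  shows "graph_coded S (topspace S - (\<Union>i. A i))"
proof -
  let ?P = "prod_topology S cantor_space"
  let ?\<Sigma> = "sigma_sets (topspace S) {U. openin S U}"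
  interpret sigma_algebra "topspace S" ?\<Sigma>
    by (rule sigma_algebra_sigma_sets) (auto dest: openin_subset)
  have "\<forall>i. \<exists>h. (\<forall>n. {x \<in> topspace S. h x n} \<in> ?\<Sigma>) \<and>
      (\<forall>x\<in>topspace S. h x 0 \<longleftrightarrow> x \<in> A i) \<and> gdelta_in ?P ((\<lambda>x. (x, h x)) ` topspace S)"
    using A unfolding graph_coded_def by (rule allI)
  from choice[OF this] obtain h where h: "\<forall>i. (\<forall>n. {x \<in> topspace S. h i x n} \<in> ?\<Sigma>) \<and>
      (\<forall>x\<in>topspace S. h i x 0 \<longleftrightarrow> x \<in> A i) \<and> gdelta_in ?P ((\<lambda>x. (x, h i x)) ` topspace S)"
    by (rule exE)
  have h_meas: "{x \<in> topspace S. h i x n} \<in> ?\<Sigma>"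
    and h0: "x \<in> topspace S \<Longrightarrow> h i x 0 \<longleftrightarrow> x \<in> A i"
    and hG: "gdelta_in ?P ((\<lambda>x. (x, h i x)) ` topspace S)" for i n x
    using h[rule_format, of i] by simp_all
  \<comment> \<open>Bit 0 is the indicator of the new set; bit
    \<open>Suc (prod_encode (i, j))\<close> is bit \<open>j\<close> of the code of
    \<open>A i\<close>.\<close>
  define k where "k x n = (case n of 0 \<Rightarrow> \<not> (\<exists>i. h i x 0)
    | Suc m \<Rightarrow> h (fst (prod_decode m)) x (snd (prod_decode m)))" for x n
  \<comment> \<open>\<open>r i\<close> extracts the \<open>i\<close>-th subcode. It is continuous,
    so that the graph of \<open>h i\<close> pulls back to a \<open>G\<^sub>\<delta>\<close>.\<close>
  define r where "r i p = (fst p :: 'a, \<lambda>j::nat. (snd p :: nat \<Rightarrow> bool) (Suc (prod_encode (i, j))))" for i p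
  have cont_r: "continuous_map ?P ?P (r i)" for i
    unfolding continuous_map_pairwise r_def
    by (auto simp: o_def continuous_map_componentwise_UNIV intro!: continuous_map_fst
        continuous_map_compose[OF continuous_map_snd, unfolded o_def] continuous_map_product_projection)
  define O1 where "O1 = {p \<in> topspace S \<times> (UNIV :: (nat \<Rightarrow> bool) set). snd p 0}"
  define O2 where "O2 i = {p \<in> topspace S \<times> UNIV. snd p (Suc (prod_encode (i, 0)))}" for i :: nat
  \<comment> \<open>This set says that bit 0 agrees with the subcodes; the set \<open>?L\<close>
    below says that every subcode is the correct one. Together they describe the graph of
    \<open>k\<close>.\<close>
  have "gdelta_in ?P (({p \<in> topspace S \<times> UNIV. \<not> snd p 0} \<inter> (\<Union>i. O2 i)) \<union>
      (O1 \<inter> (\<Inter>i. {p \<in> topspace S \<times> UNIV. \<not> snd p (Suc (prod_encode (i, 0)))})))"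
    (is "gdelta_in ?P ?K") unfolding O1_def O2_def
    by (intro gdelta_in_Un gdelta_in_Int open_imp_gdelta_in[OF openin_coordinate]
        open_imp_gdelta_in[OF openin_Union] gdelta_in_Inter closedin_imp_gdelta[OF closedin_coordinate])
      (auto intro!: openin_coordinate closedin_imp_gdelta[OF closedin_coordinate])
  moreover have "gdelta_in ?P (\<Inter>i. {p \<in> topspace ?P. r i p \<in> (\<lambda>x. (x, h i x)) ` topspace S})"
    (is "gdelta_in ?P ?L")
    using gdelta_in_continuous_map_preimage[OF cont_r hG] by (intro gdelta_in_Inter) auto
  ultimately have "gdelta_in ?P (?K \<inter> ?L)" by (rule gdelta_in_Int)
  also have "?K \<inter> ?L = (\<lambda>x. (x, k x)) ` topspace S"
  proof (intro set_eqI iffI)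
    fix p assume p: "p \<in> ?K \<inter> ?L"
    obtain x z where pz: "p = (x, z)" by (cases p)
    have x: "x \<in> topspace S" using p pz by auto
    have z: "z (Suc (prod_encode (i, j))) = h i x j" for i j
      using p by (auto simp: pz r_def image_iff fun_eq_iff)
    have "z n = k x n" for n
    proof (cases n)
      case 0
      then show ?thesis using p z by (auto simp: pz k_def O1_def O2_def)
    next
      case (Suc m)
      then show ?thesis
        using z[of "fst (prod_decode m)" "snd (prod_decode m)"] by (simp add: k_def)
    qed
    then show "p \<in> (\<lambda>x. (x, k x)) ` topspace S" using x pz by auto
  next
    fix p assume "p \<in> (\<lambda>x. (x, k x)) ` topspace S"
    then show "p \<in> ?K \<inter> ?L"
      by (auto simp: k_def O1_def O2_def r_def image_iff fun_eq_iff)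
  qed
  finally have G: "gdelta_in ?P ((\<lambda>x. (x, k x)) ` topspace S)" .
  have "{x \<in> topspace S. k x n} \<in> ?\<Sigma>" for n
  proof (cases n)
    case 0
    have "{x \<in> topspace S. k x n} = topspace S - (\<Union>i. {x \<in> topspace S. h i x 0})"
      using 0 by (auto simp: k_def)
    then show ?thesis using sigma_sets.Compl[OF sigma_sets.Union[OF h_meas]] by simp
  next
    case (Suc m)
    then show ?thesis using h_meas by (simp add: k_def)
  qed
  moreover have "\<forall>x\<in>topspace S. k x 0 \<longleftrightarrow> x \<in> topspace S - (\<Union>i. A i)"
    using h0 by (auto simp: k_def)
  ultimately show ?thesis unfolding graph_coded_def using G by blast
qed

text \<open>A complement is the combined operation on a constant sequence, and a union is the
  complement of its complement.\<close>

lemma graph_coded_sigma_sets: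
  assumes "A \<in> sigma_sets (topspace S) {U. openin S U}"
  shows "graph_coded S A"
  using assms
proof induction
  case (Basic a)
  then show ?case by (simp add: graph_coded_openin)
next
  case Empty
  then show ?case by (simp add: graph_coded_openin)
next
  case (Compl a)
  then show ?case using graph_coded_Union_compl[of "\<lambda>_. a"] by simp
next
  case (Union a)
  have sub: "a i \<subseteq> topspace S" for i
    using sigma_sets_into_sp[OF _ Union(1)[of i]] openin_subset by blast
  have "graph_coded S (topspace S - (topspace S - (\<Union>i. a i)))"
    using graph_coded_Union_compl[of "\<lambda>_. topspace S - (\<Union>i. a i)"] graph_coded_Union_compl[of a] Union
    by auto
  then show ?case using sub by (simp add: double_diff UN_least)
qed

end


text \<open>The transported topology has more open sets than the subspace topology. It generates no
  new Borel sets because its countable base consists of sets defined by the measurable bits of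
  \<open>h\<close>.\<close>

lemma standard_Borel_restrict_space:
  assumes "standard_Borel M" and A: "A \<in> sets M"
  shows "standard_Borel (restrict_space M A)"
proof -
  obtain S where cm: "completely_metrizable_space S" and sep: "separable_space S"
    and top: "topspace S = space M" and sets: "sets M = sigma_sets (topspace S) {U. openin S U}"
    using assms(1) by (auto simp: standard_Borel_def)
  have AS: "A \<subseteq> topspace S" using sets.sets_into_space[OF A] top by simp
  let ?P = "prod_topology S cantor_space"
  obtain h where h_meas: "\<And>n. {x \<in> topspace S. h x n} \<in> sets M"
    and h0: "\<And>x. x \<in> topspace S \<Longrightarrow> h x (0::nat) \<longleftrightarrow> x \<in> A"
    and hG: "gdelta_in ?P ((\<lambda>x. (x, h x)) ` topspace S)"
    using graph_coded_sigma_sets[OF cm A[unfolded sets]] unfolding graph_coded_def sets by blast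
  let ?e = "\<lambda>x. (x, h x)"
  let ?E = "?e ` A"
  \<comment> \<open>Over \<open>A\<close> the graph is cut out by the open condition that bit 0 is
    on, hence remains \<open>G\<^sub>\<delta>\<close>.\<close>
  have "gdelta_in ?P (?e ` topspace S \<inter> {p \<in> topspace S \<times> UNIV. snd p 0})"
    by (intro gdelta_in_Int hG open_imp_gdelta_in openin_coordinate[OF cm])
  also have "?e ` topspace S \<inter> {p \<in> topspace S \<times> UNIV. snd p 0} = ?E"
    using h0 AS by auto
  finally have EG: "gdelta_in ?P ?E" .
  have cmE: "completely_metrizable_space (subtopology ?P ?E)"
    by (rule completely_metrizable_space_gdelta_in[OF metrizable_prod_cantor[OF cm] EG])
  define S' where "S' = pullback_topology A ?e ?P"
  have topS': "topspace S' = A"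
    using AS by (auto simp: S'_def topspace_pullback_topology)
  have op: "openin S' V \<longleftrightarrow> (\<exists>W. openin ?P W \<and> V = ?e -` W \<inter> A)" for V
    by (simp add: S'_def openin_pullback_topology)
  have "homeomorphic_maps S' (subtopology ?P ?E) ?e fst"
    unfolding homeomorphic_maps_def
  proof (intro conjI)
    show "continuous_map S' (subtopology ?P ?E) ?e"
      unfolding continuous_map_in_subtopology
    proof
      show "continuous_map S' ?P ?e"
        unfolding continuous_map
      proof (intro conjI allI impI)
        fix U assume "openin ?P U"
        then show "openin S' {x \<in> topspace S'. (x, h x) \<in> U}"
          unfolding op topS' by (intro exI[of _ U]) auto
      qed (use topS' AS in auto)
    qed (use topS' in auto)
    show "continuous_map (subtopology ?P ?E) S' fst"
      unfolding continuous_map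
    proof (intro conjI allI impI)
      fix U assume "openin S' U"
      then obtain W where W: "openin ?P W" "U = ?e -` W \<inter> A" by (auto simp: op)
      have "{x \<in> topspace (subtopology ?P ?E). fst x \<in> U} = W \<inter> ?E"
        using W AS by auto
      then show "openin (subtopology ?P ?E) {x \<in> topspace (subtopology ?P ?E). fst x \<in> U}"
        using W(1) by (auto simp: openin_subtopology)
    qed (use topS' AS in auto)
  qed (auto simp: topS')
  then have hom: "S' homeomorphic_space subtopology ?P ?E"
    unfolding homeomorphic_space_def by blast
  then have cmS': "completely_metrizable_space S'"
    using cmE homeomorphic_completely_metrizable_space by blast
  have "second_countable S"
    by (intro separable_metrizable_imp_second_countable completely_metrizable_imp_metrizable_space cm sep)
  then obtain \<B> where \<B>: "countable \<B>" "\<And>V. V \<in> \<B> \<Longrightarrow> openin S V"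
    "\<And>U x. openin S U \<Longrightarrow> x \<in> U \<Longrightarrow> \<exists>V\<in>\<B>. x \<in> V \<and> V \<subseteq> U"
    by (rule second_countableE) blast
  \<comment> \<open>This countable base is used twice: for separability of \<open>S'\<close>, and to
    write each \<open>S'\<close>-open set as a countable union of sets already measurable in the
    restricted space.\<close>
  define \<C> where "\<C> = (\<lambda>(V, s). {x \<in> A. x \<in> V \<and> h x \<in> cylinder s}) ` (\<B> \<times> UNIV)"
  have cC: "countable \<C>" unfolding \<C>_def using \<B>(1) by auto
  have base: "\<exists>C\<in>\<C>. x \<in> C \<and> C \<subseteq> U" if U: "openin S' U" "x \<in> U" for U x
  proof -
    from U obtain W where W: "openin ?P W" "U = ?e -` W \<inter> A" by (auto simp: op)
    then have xW: "(x, h x) \<in> W" and xA: "x \<in> A" using U by auto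
    obtain V Z where VZ: "openin S V" "openin cantor_space Z" "x \<in> V" "h x \<in> Z" "V \<times> Z \<subseteq> W"
      using W(1)[unfolded openin_prod_topology_alt, rule_format, OF xW] by (elim exE conjE)
    obtain B where B: "B \<in> \<B>" "x \<in> B" "B \<subseteq> V" using \<B>(3)[OF VZ(1,3)] by blast
    obtain s where s: "h x \<in> cylinder s" "cylinder s \<subseteq> Z" using cylinder_base[OF VZ(2,4)] .
    have "B \<times> cylinder s \<subseteq> W" using B s VZ by blast
    then show ?thesis
      by (intro bexI[of _ "{x \<in> A. x \<in> B \<and> h x \<in> cylinder s}"])
        (use B s W xA in \<open>auto simp: \<C>_def\<close>)
  qed
  have openC: "openin S' C" if C: "C \<in> \<C>" for C
  proof -
    obtain V s where Vs: "V \<in> \<B>" "C = {x \<in> A. x \<in> V \<and> h x \<in> cylinder s}"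
      using C by (auto simp: \<C>_def)
    have "openin ?P (V \<times> cylinder s)"
      using \<B>(2)[OF Vs(1)] openin_cylinder by (simp add: openin_prod_Times_iff)
    then show ?thesis unfolding op by (rule_tac exI[of _ "V \<times> cylinder s"]) (auto simp: Vs(2))
  qed
  have "second_countable S'"
    unfolding second_countable_def using cC openC base by (intro exI[of _ \<C>]) simp
  then have sepS': "separable_space S'" by (rule second_countable_imp_separable_space)
  have sp: "space (restrict_space M A) = A"
    using AS top by (auto simp: space_restrict_space)
  have measC: "C \<in> sets (restrict_space M A)" if C: "C \<in> \<C>" for C
  proof -
    obtain V s where Vs: "V \<in> \<B>" "C = {x \<in> A. x \<in> V \<and> h x \<in> cylinder s}"
      using C by (auto simp: \<C>_def)
    have V: "V \<in> sets M" using \<B>(2)[OF Vs(1)] by (auto simp: sets)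
    have "{x \<in> space M. h x i = b} \<in> sets M" for i b
      using h_meas[of i] sets.compl_sets[OF h_meas[of i]] top
      by (cases b) (auto simp: set_diff_eq elim!: back_subst[of "\<lambda>x. x \<in> sets M"])
    then have "{x \<in> space M. \<forall>i\<in>{..<length s}. h x i = s ! i} \<in> sets M"
      by (intro sets.sets_Collect_finite_All) auto
    then have "V \<inter> {x \<in> space M. \<forall>i\<in>{..<length s}. h x i = s ! i} \<in> sets M"
      using V by auto
    moreover have "C = A \<inter> (V \<inter> {x \<in> space M. \<forall>i\<in>{..<length s}. h x i = s ! i})"
      using AS top by (auto simp: Vs(2) cylinder_def)
    ultimately show ?thesis unfolding sets_restrict_space by blast
  qed
  have "sets (restrict_space M A) = (\<inter>) A ` sigma_sets (topspace S) {U. openin S U}"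
    by (simp add: sets_restrict_space sets)
  also have "\<dots> = sigma_sets A ((\<inter>) A ` {U. openin S U})"
    by (rule sigma_sets_Int) (use A AS sets in auto)
  finally have sets_A: "sets (restrict_space M A) = sigma_sets A ((\<inter>) A ` {U. openin S U})" .
  have "sets (restrict_space M A) = sigma_sets A {U. openin S' U}"
  proof
    have "openin S' (A \<inter> U)" if U: "openin S U" for U
    proof -
      have "openin ?P (U \<times> UNIV)"
        using U openin_topspace[of cantor_space] by (simp add: openin_prod_Times_iff)
      then show ?thesis unfolding op by (rule_tac exI[of _ "U \<times> UNIV"]) auto
    qed
    then show "sets (restrict_space M A) \<subseteq> sigma_sets A {U. openin S' U}"
      unfolding sets_A by (intro sigma_sets_mono') auto
    have "U \<in> sets (restrict_space M A)" if U: "openin S' U" for U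
    proof -
      have "U = \<Union>{C \<in> \<C>. C \<subseteq> U}" using base[OF U] by blast
      moreover have "\<Union>{C \<in> \<C>. C \<subseteq> U} \<in> sets (restrict_space M A)"
        by (intro sets.countable_Union) (use measC cC in \<open>auto intro: countable_subset\<close>)
      ultimately show ?thesis by simp
    qed
    then show "sigma_sets A {U. openin S' U} \<subseteq> sets (restrict_space M A)"
      using sets.sigma_sets_subset[of "{U. openin S' U}" "restrict_space M A"] by (simp add: sp subset_iff)
  qed
  then show ?thesis
    unfolding standard_Borel_def sp using cmS' sepS' topS' by blast
qed

text \<open>The bits are the indicators of a countable base, which separates points by the Hausdorff
  property.\<close>

lemma standard_Borel_separating_sequence:
  assumes "standard_Borel N"
  obtains h :: "'a \<Rightarrow> nat \<Rightarrow> bool" where "\<And>n. {x \<in> space N. h x n} \<in> sets N" and "inj_on h (space N)"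
proof -
  obtain S where cm: "completely_metrizable_space S" and sep: "separable_space S"
    and top: "topspace S = space N" and sets: "sets N = sigma_sets (space N) {U. openin S U}"
    using assms by (auto simp: standard_Borel_def)
  have ms: "metrizable_space S" using cm by (rule completely_metrizable_imp_metrizable_space)
  then have "second_countable S" using sep by (rule separable_metrizable_imp_second_countable)
  then obtain \<B> where \<B>: "countable \<B>" "\<And>V. V \<in> \<B> \<Longrightarrow> openin S V"
    "\<And>U x. openin S U \<Longrightarrow> x \<in> U \<Longrightarrow> \<exists>V\<in>\<B>. x \<in> V \<and> V \<subseteq> U"
    by (rule second_countableE) blast
  \<comment> \<open>The empty set is inserted so that \<open>from_nat_into\<close> enumerates a
    nonempty set even if the carrier is empty.\<close>
  define h where "h x n \<longleftrightarrow> x \<in> from_nat_into (insert {} \<B>) n" for x n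
  have op: "openin S (from_nat_into (insert {} \<B>) n)" for n
    using from_nat_into[of "insert {} \<B>" n] \<B>(2) by auto
  show thesis
  proof (rule that)
    show "{x \<in> space N. h x n} \<in> sets N" for n
    proof -
      have "{x \<in> space N. h x n} = from_nat_into (insert {} \<B>) n"
        using openin_subset[OF op] top by (auto simp: h_def)
      then show ?thesis using op by (auto simp: sets)
    qed
    show "inj_on h (space N)"
    proof (rule inj_onI, rule ccontr)
      fix x y assume xy: "x \<in> space N" "y \<in> space N" "h x = h y" "x \<noteq> y"
      then obtain U where U: "openin S U" "x \<in> U" "y \<notin> U"
        using metrizable_imp_Hausdorff_space[OF ms] top
        unfolding Hausdorff_space_def disjnt_iff by metis
      obtain V where V: "V \<in> \<B>" "x \<in> V" "V \<subseteq> U" using \<B>(3)[OF U(1,2)] by blast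
      obtain n where "V = from_nat_into (insert {} \<B>) n"
        using from_nat_into_surj[of "insert {} \<B>" V] V(1) \<B>(1) by auto
      then show False using xy(3) V U(3) by (auto simp: h_def fun_eq_iff)
    qed
  qed
qed

subsection \<open>Null Cantor sets in diffuse measure spaces\<close>

locale diffuse_Polish_measure = finite_measure N + Metric_space "space N" d
  for N :: "'a measure" and d +
  assumes complete: mcomplete
    and separable: "separable_space mtopology"
    and sets_eq: "sets N = sigma_sets (space N) {U. openin mtopology U}"
    and points_null: "\<And>x. x \<in> space N \<Longrightarrow> measure N {x} = 0"
    and space_not_null: "measure N (space N) > 0"
begin

section \<open>Borel balls and the support\<close>

lemma sets_openin: "openin mtopology U \<Longrightarrow> U \<in> sets N"
  by (simp add: sets_eq)

lemma sets_mball: "mball x r \<in> sets N"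
  by (intro sets_openin) simp

lemma sets_closedin: "closedin mtopology C \<Longrightarrow> C \<in> sets N"
  using sets_openin[of "space N - C"] sets.compl_sets[of "space N - C" N]
  by (auto simp: closedin_def double_diff)

lemma sets_mcball: "mcball x r \<in> sets N"
  by (intro sets_closedin) simp

definition support :: "'a set" where
  "support = {x \<in> space N. \<forall>r>0. measure N (mball x r) > 0}"

text \<open>Otherwise each point of \<open>V\<close> lies in a null member of a countable base, and
  \<open>V\<close> is covered by countably many null sets.\<close>

lemma support_meets_open:
  assumes V: "openin mtopology V" and pos: "measure N V > 0"
  obtains x where "x \<in> V" and "x \<in> support"
proof (rule ccontr)
  assume "\<not> thesis"
  with that have ns: "\<And>x. x \<in> V \<Longrightarrow> x \<notin> support" by blast
  have "second_countable mtopology"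
    using separable_metrizable_imp_second_countable metrizable_space_mtopology separable by blast
  then obtain \<B> where \<B>: "countable \<B>" "\<And>V. V \<in> \<B> \<Longrightarrow> openin mtopology V"
    "\<And>U x. openin mtopology U \<Longrightarrow> x \<in> U \<Longrightarrow> \<exists>V\<in>\<B>. x \<in> V \<and> V \<subseteq> U"
    by (rule second_countableE) blast
  have "(\<Union>B\<in>{B\<in>\<B>. measure N B = 0}. B) \<in> null_sets N"
    by (intro null_sets_UN')
      (use \<B>(1,2) sets_openin in \<open>auto simp: null_sets_def emeasure_eq_measure intro: countable_subset\<close>)
  moreover have "V \<subseteq> (\<Union>B\<in>{B\<in>\<B>. measure N B = 0}. B)"
  proof
    fix x assume x: "x \<in> V"
    then have xN: "x \<in> space N" using openin_subset[OF V] by auto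
    then obtain r where r: "r > 0" "measure N (mball x r) = 0"
      using ns[OF x] zero_less_measure_iff by (auto simp: support_def)
    obtain B where B: "B \<in> \<B>" "x \<in> B" "B \<subseteq> mball x r"
      using \<B>(3)[OF openin_mball, of x x r] xN r(1) by auto
    have "measure N B = 0"
      using finite_measure_mono[OF B(3) sets_mball] r(2) measure_nonneg[of N B] by linarith
    then show "x \<in> (\<Union>B\<in>{B\<in>\<B>. measure N B = 0}. B)" using B by blast
  qed
  ultimately have "V \<in> null_sets N" using null_sets_subset sets_openin[OF V] by blast
  then have "measure N V = 0" by (simp add: null_sets_def measure_def)
  with pos show False by simp
qed

text \<open>Closed balls around \<open>x\<close> shrink to the null set \<open>{x}\<close>, and a
  finite measure is continuous from above.\<close>

lemma small_mcball:
  assumes x: "x \<in> space N" and e: "e > 0"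
  obtains r where "0 < r" "r \<le> e" "measure N (mcball x r) < e"
proof -
  let ?A = "\<lambda>n. mcball x (e / real (Suc n))"
  have "(\<lambda>n. measure N (?A n)) \<longlonglongrightarrow> measure N (\<Inter>n. ?A n)"
  proof (intro finite_Lim_measure_decseq)
    show "range ?A \<subseteq> sets N" using sets_mcball by auto
    show "decseq ?A"
      unfolding decseq_def using e
      by (intro allI impI mcball_subset_concentric divide_left_mono) auto
  qed
  moreover have "(\<Inter>n. ?A n) = {x}"
  proof
    show "(\<Inter>n. ?A n) \<subseteq> {x}"
    proof
      fix y assume y: "y \<in> (\<Inter>n. ?A n)"
      then have yN: "y \<in> space N" and le: "\<And>n. d x y \<le> e / real (Suc n)" by auto
      have "(\<lambda>n. e / real (Suc n)) \<longlonglongrightarrow> 0"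
        using LIMSEQ_inverse_real_of_nat tendsto_mult_right_zero[of _ _ e]
        by (fastforce simp: divide_inverse)
      then have "d x y \<le> 0" using le by (intro LIMSEQ_le_const) auto
      then show "y \<in> {x}" using x yN nonneg[of x y] by (metis antisym singletonI zero)
    qed
  qed (use x e in auto)
  ultimately have "(\<lambda>n. measure N (?A n)) \<longlonglongrightarrow> 0" using points_null[OF x] by simp
  then have "\<forall>\<^sub>F n in sequentially. measure N (?A n) < e" using e by (rule order_tendstoD)
  then obtain n where "measure N (?A n) < e" by (auto simp: eventually_sequentially)
  then show thesis using e by (intro that[of "e / real (Suc n)"]) (auto simp: field_simps)
qed

section \<open>The Cantor scheme and its branches\<close>

definition nice :: "'a \<times> real \<Rightarrow> bool" where
  "nice p \<longleftrightarrow> fst p \<in> support \<and> snd p > 0"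

abbreviation disc :: "'a \<times> real \<Rightarrow> 'a set" where
  "disc p \<equiv> mcball (fst p) (snd p)"

text \<open>Discs are closed so that completeness yields a point on each branch. The bound on radii
  makes this point unique; the bound on measures makes the set of branches null.\<close>

definition splits :: "real \<Rightarrow> 'a \<times> real \<Rightarrow> (bool \<Rightarrow> 'a \<times> real) \<Rightarrow> bool" where
  "splits e p q \<longleftrightarrow> (\<forall>b. nice (q b) \<and> snd (q b) \<le> e \<and> measure N (disc (q b)) \<le> e \<and>
     disc (q b) \<subseteq> disc p) \<and> disc (q True) \<inter> disc (q False) = {}"

text \<open>The open ball has positive measure because its centre is in the support. It contains a
  support point \<open>x\<close>; deleting the null point \<open>x\<close> leaves positive measure,
  hence a second support point \<open>y\<close>.\<close>

lemma ex_splits: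
  assumes p: "nice p" and e: "e > 0"
  shows "\<exists>q. splits e p q"
proof -
  let ?B = "mball (fst p) (snd p)"
  have pos: "measure N ?B > 0" using p by (auto simp: nice_def support_def)
  obtain x where x: "x \<in> ?B" "x \<in> support" using support_meets_open[OF openin_mball pos] .
  have xN: "x \<in> space N" using x(1) by auto
  have op: "openin mtopology (?B - {x})"
    by (intro openin_diff openin_mball) (use xN in \<open>simp add: closedin_Hausdorff_sing_eq Hausdorff_space_mtopology\<close>)
  have "measure N (?B - {x}) = measure N ?B - measure N {x}"
    by (intro finite_measure_Diff sets_mball)
      (use x xN in \<open>auto intro!: sets_closedin simp: closedin_Hausdorff_sing_eq Hausdorff_space_mtopology\<close>)
  then have "measure N (?B - {x}) > 0" using pos points_null[OF xN] by simp
  then obtain y where y: "y \<in> ?B - {x}" "y \<in> support" using support_meets_open[OF op] by blast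
  have yN: "y \<in> space N" using y(1) by auto
  have dxy: "d x y > 0" using xN yN y(1) nonneg[of x y] zero[of x y] by (metis DiffD2 insertCI order_le_less)
  \<comment> \<open>Halving makes all bounds strict. The third of \<open>d x y\<close> keeps the two
    discs disjoint, and the last two terms keep them inside the disc of \<open>p\<close>.\<close>
  define t where "t = Min {e, d x y / 3, snd p - d (fst p) x, snd p - d (fst p) y} / 2"
  have t: "t > 0" "t < e" "t < d x y / 3" "t < snd p - d (fst p) x" "t < snd p - d (fst p) y"
    using e dxy x(1) y(1) by (auto simp: t_def min_def)
  obtain r s where r: "0 < r" "r \<le> t" "measure N (mcball x r) < t"
    and s: "0 < s" "s \<le> t" "measure N (mcball y s) < t"
    using small_mcball[OF xN t(1)] small_mcball[OF yN t(1)] by metis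
  define q where "q b = (if b then (x, r) else (y, s))" for b
  have fp: "fst p \<in> space N" using x(1) by auto
  have "mcball x r \<inter> mcball y s = {}"
  proof (rule ccontr)
    assume "mcball x r \<inter> mcball y s \<noteq> {}"
    then obtain z where z: "z \<in> space N" "d x z \<le> r" "d y z \<le> s" by auto
    have "d x y \<le> d x z + d z y" using xN yN z(1) by (intro triangle)
    then show False using z r s t dxy by (simp add: commute)
  qed
  moreover have "mcball x r \<subseteq> disc p" "mcball y s \<subseteq> disc p"
    using r s t fp by (intro mcball_subset; simp add: commute)+
  ultimately have "splits e p q"
    using x y r s t by (auto simp: splits_def nice_def q_def)
  then show ?thesis by (intro exI[of _ q])
qed

text \<open>
  A Cantor scheme of closed balls: at level \<open>n\<close> there are \<open>2\<^sup>n\<close> of them, of measure at most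
  \<open>4 / 4\<^sup>n\<close> each, so that the set of branches is null.
\<close>

primrec node :: "('a \<times> real) \<Rightarrow> (nat \<Rightarrow> bool) \<Rightarrow> nat \<Rightarrow> 'a \<times> real" where
  "node p z 0 = p"
| "node p z (Suc n) = (SOME q. splits (1 / 4 ^ n) (node p z n) q) (z n)"

context
  fixes p assumes p: "nice p"
begin

lemma nice_node: "nice (node p z n)"
proof (induction n)
  case (Suc n)
  have "splits (1 / 4 ^ n) (node p z n) (SOME q. splits (1 / 4 ^ n) (node p z n) q)"
    by (rule someI_ex[OF ex_splits[OF Suc]]) simp
  then show ?case by (simp add: splits_def)
qed (simp add: p)

lemma splits_node:
  "splits (1 / 4 ^ n) (node p z n) (SOME q. splits (1 / 4 ^ n) (node p z n) q)"
  by (rule someI_ex[OF ex_splits[OF nice_node]]) simp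

lemma node_cong: "(\<And>i. i < n \<Longrightarrow> z i = z' i) \<Longrightarrow> node p z n = node p z' n"
  by (induction n) auto

lemma radius_node: "snd (node p z (Suc n)) \<le> 1 / 4 ^ n"
  and measure_node: "measure N (disc (node p z (Suc n))) \<le> 1 / 4 ^ n"
  and node_subset: "disc (node p z (Suc n)) \<subseteq> disc (node p z n)"
  using splits_node[of n z] by (simp_all add: splits_def)

text \<open>The first \<open>n\<close> choices agree, so the two discs are the two children of the
  same node.\<close>

lemma node_disjoint:
  assumes "\<And>i. i < n \<Longrightarrow> z i = z' i" and "z n \<noteq> z' n"
  shows "disc (node p z (Suc n)) \<inter> disc (node p z' (Suc n)) = {}"
  using splits_node[of n z] node_cong[OF assms(1)] assms(2)
  by (cases "z n"; cases "z' n") (auto simp: splits_def)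

lemma decseq_node: "decseq (\<lambda>n. disc (node p z n))"
  by (rule decseq_SucI) (rule node_subset)

text \<open>This is Cantor's intersection theorem for nested nonempty closed sets contained in
  arbitrarily small balls.\<close>

lemma branch_point: "\<exists>x. x \<in> space N \<and> (\<Inter>n. disc (node p z n)) = {x}"
proof -
  have 1: "\<forall>n. closedin mtopology (disc (node p z n))" by simp
  have 2: "\<forall>n. disc (node p z n) \<noteq> {}"
  proof
    fix n
    have "fst (node p z n) \<in> disc (node p z n)"
      using nice_node[of z n] by (auto simp: nice_def support_def)
    then show "disc (node p z n) \<noteq> {}" by blast
  qed
  have 3: "\<forall>e>0. \<exists>n a. disc (node p z n) \<subseteq> mcball a e"
  proof (intro allI impI)
    fix e :: real assume "e > 0"
    then obtain n where "(1 / 4) ^ n < e" using real_arch_pow_inv[of e "1/4"] by auto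
    then have "snd (node p z (Suc n)) \<le> e" using radius_node[of z n] by (simp add: power_divide)
    then show "\<exists>n a. disc (node p z n) \<subseteq> mcball a e"
      using mcball_subset_concentric by blast
  qed
  show ?thesis
    using complete[unfolded mcomplete_nest_sing, rule_format, OF conjI[OF 1 conjI[OF 2 conjI[OF decseq_node 3]]]] .
qed

definition branch :: "(nat \<Rightarrow> bool) \<Rightarrow> 'a" where
  "branch z = (SOME x. x \<in> space N \<and> (\<Inter>n. disc (node p z n)) = {x})"

lemma branch: "branch z \<in> space N" "branch z \<in> disc (node p z n)"
proof -
  have b: "branch z \<in> space N" "(\<Inter>n. disc (node p z n)) = {branch z}"
    using someI_ex[OF branch_point[of z]] unfolding branch_def[symmetric] by simp_all
  show "branch z \<in> space N" by (rule b)
  show "branch z \<in> disc (node p z n)" using b(2) by blast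
qed

lemma inj_branch: "inj branch"
proof (rule injI, rule ccontr)
  fix z z' assume eq: "branch z = branch z'" and "z \<noteq> z'"
  then obtain k where "z k \<noteq> z' k" by auto
  then obtain n where "z n \<noteq> z' n" "\<And>i. i < n \<Longrightarrow> z i = z' i"
    using exists_least_iff[of "\<lambda>k. z k \<noteq> z' k"] by blast
  then have "disc (node p z (Suc n)) \<inter> disc (node p z' (Suc n)) = {}"
    by (intro node_disjoint)
  then show False using branch(2)[of z "Suc n"] branch(2)[of z' "Suc n"] eq by auto
qed

text \<open>A word \<open>s\<close> is passed as the sequence \<open>(!) s\<close>; its unspecified
  values from \<open>length s\<close> on are never read, as stage \<open>n\<close> depends only on
  the first \<open>n\<close> bits.\<close>

definition level :: "nat \<Rightarrow> 'a set" where
  "level n = (\<Union>s\<in>{s :: bool list. length s = n}. disc (node p ((!) s) n))"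

lemma finite_words: "finite {s :: bool list. length s = n}"
  and card_words: "card {s :: bool list. length s = n} = 2 ^ n"
  using finite_lists_length_eq[of "UNIV :: bool set" n] card_lists_length_eq[of "UNIV :: bool set" n]
  by auto

lemma node_word: "node p ((!) (map z [0..<n])) n = node p z n"
  by (rule node_cong) simp

lemma branch_in_level: "branch z \<in> level n"
  unfolding level_def
  by (rule UN_I[of "map z [0..<n]"]) (use branch(2)[of z n] in \<open>simp_all only: node_word, simp_all\<close>)

lemma sets_level: "level n \<in> sets N"
  unfolding level_def using sets_mcball finite_words by auto

lemma null_levels: "(\<Inter>n. level n) \<in> null_sets N"
proof -
  \<comment> \<open>Level \<open>Suc n\<close> has \<open>2 ^ Suc n\<close> discs of measure at most
    \<open>1 / 4 ^ n\<close> each.\<close>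
  have "measure N (\<Inter>n. level n) \<le> 2 * (1 / 2) ^ n" for n
  proof -
    have "measure N (\<Inter>n. level n) \<le> measure N (level (Suc n))"
      by (rule finite_measure_mono) (auto intro: sets_level)
    also have "\<dots> \<le> (\<Sum>s\<in>{s :: bool list. length s = Suc n}. measure N (disc (node p ((!) s) (Suc n))))"
      unfolding level_def
      by (rule measure_UNION_le) (auto intro: sets_mcball finite_words)
    also have "\<dots> \<le> (\<Sum>s\<in>{s :: bool list. length s = Suc n}. 1 / 4 ^ n)"
      by (intro sum_mono measure_node)
    also have "\<dots> = 2 * (1 / 2) ^ n"
    proof -
      have "(4::real) ^ n = 2 ^ n * 2 ^ n" by (simp flip: power_mult_distrib)
      then show ?thesis by (simp add: card_words power_divide)
    qed
    finally show ?thesis .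
  qed
  moreover have "(\<lambda>n. 2 * (1 / 2 :: real) ^ n) \<longlonglongrightarrow> 0"
    by (intro tendsto_mult_right_zero LIMSEQ_power_zero) simp
  ultimately have "measure N (\<Inter>n. level n) \<le> 0"
    by (intro LIMSEQ_le_const) blast+
  then have "measure N (\<Inter>n. level n) = 0" using measure_nonneg by (rule antisym)
  moreover have "(\<Inter>n. level n) \<in> sets N" using sets_level by blast
  ultimately show ?thesis by (simp add: null_sets_def emeasure_eq_measure)
qed

text \<open>In effect \<open>branch\<close> is continuous on Cantor space: it maps into an open set
  as soon as a finite prefix determines a disc inside that set. There are only countably many
  prefixes.\<close>

lemma measurable_branch:
  assumes h: "\<And>n. {x \<in> space L. h x n} \<in> sets L"
  shows "(\<lambda>x. branch (h x)) \<in> L \<rightarrow>\<^sub>M N"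
proof (rule measurable_sigma_sets[OF sets_eq])
  show "{U. openin mtopology U} \<subseteq> Pow (space N)" using openin_subset by fastforce
  show "(\<lambda>x. branch (h x)) \<in> space L \<rightarrow> space N" using branch(1) by auto
  have word: "{x \<in> space L. \<forall>i\<in>{..<length s}. h x i = s ! i} \<in> sets L" for s
  proof (intro sets.sets_Collect_finite_All)
    fix i
    show "{x \<in> space L. h x i = s ! i} \<in> sets L"
      using h[of i] sets.compl_sets[OF h[of i]]
      by (cases "s ! i") (auto simp: set_diff_eq elim!: back_subst[of "\<lambda>x. x \<in> sets L"])
  qed simp
  fix W assume "W \<in> {U. openin mtopology U}"
  then have W: "openin mtopology W" by simp
  have "(\<lambda>x. branch (h x)) -` W \<inter> space L =
    (\<Union>s\<in>{s. disc (node p ((!) s) (length s)) \<subseteq> W}. {x \<in> space L. \<forall>i\<in>{..<length s}. h x i = s ! i})"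
    (is "?L = ?R")
  proof (intro set_eqI iffI)
    fix x assume x: "x \<in> ?L"
    then obtain e where e: "e > 0" "mball (branch (h x)) e \<subseteq> W"
      using W unfolding openin_mtopology by blast
    \<comment> \<open>Both the branch point and \<open>y\<close> are within \<open>e / 2\<close> of
      the centre of the disc, hence the factor 2.\<close>
    obtain n where n: "(1 / 4) ^ n < e / 2" using real_arch_pow_inv[of "e/2" "1/4"] e(1) by auto
    let ?s = "map (h x) [0..<Suc n]" and ?c = "node p (h x) (Suc n)"
    have c: "fst ?c \<in> space N" "snd ?c < e / 2"
      using nice_node[of "h x" "Suc n"] radius_node[of "h x" n] n
      by (auto simp: nice_def support_def power_divide simp del: node.simps)
    have "disc ?c \<subseteq> mball (branch (h x)) e"
    proof
      fix y assume y: "y \<in> disc ?c"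
      have "d (branch (h x)) y \<le> d (branch (h x)) (fst ?c) + d (fst ?c) y"
        using y branch(1) c(1) by (intro triangle) (auto simp del: node.simps)
      also have "\<dots> < e" using y branch(2)[of "h x" "Suc n"] c(2)
        by (auto simp: commute simp del: node.simps)
      finally show "y \<in> mball (branch (h x)) e" using y branch(1) by (auto simp del: node.simps)
    qed
    then have "disc ?c \<subseteq> W" using e(2) by blast
    then have "disc (node p ((!) ?s) (length ?s)) \<subseteq> W" by (simp only: node_word length_map length_upt diff_zero)
    then show "x \<in> ?R" using x by (intro UN_I[of ?s]) (auto simp del: upt_Suc)
  next
    fix x assume "x \<in> ?R"
    then obtain s where s: "disc (node p ((!) s) (length s)) \<subseteq> W" "x \<in> space L"
      "\<And>i. i < length s \<Longrightarrow> h x i = s ! i" by auto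
    have "node p ((!) s) (length s) = node p (h x) (length s)"
      using s(3) by (intro node_cong) simp
    then show "x \<in> ?L" using s branch(2)[of "h x" "length s"] by auto
  qed
  then show "(\<lambda>x. branch (h x)) -` W \<inter> space L \<in> sets L"
    using word by (auto intro!: sets.countable_UN')
qed

end

end

text \<open>Cantor space serves as the intermediary: \<open>L\<close> is coded injectively into it
  by a separating sequence, and \<open>branch\<close> carries it injectively into a null subset of
  \<open>N\<close>.\<close>

lemma ex_measurable_inj_into_null_set:
  assumes fin: "finite_measure N" and N: "standard_Borel N"
    and points: "\<And>x. x \<in> space N \<Longrightarrow> emeasure N {x} = 0"
    and nz: "emeasure N (space N) \<noteq> 0"
    and L: "standard_Borel L"
  obtains g K where "K \<in> null_sets N" "g \<in> L \<rightarrow>\<^sub>M N" "inj_on g (space L)" "g ` space L \<subseteq> K"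
proof -
  obtain S where cm: "completely_metrizable_space S" and sep: "separable_space S"
    and top: "topspace S = space N" and sets: "sets N = sigma_sets (space N) {U. openin S U}"
    using N by (auto simp: standard_Borel_def)
  obtain X d where Xd: "Metric_space X d" "Metric_space.mcomplete X d" "S = Metric_space.mtopology X d"
    using cm by (auto simp: completely_metrizable_space_def)
  have X: "X = space N" using top Xd Metric_space.topspace_mtopology by metis
  interpret finite_measure N by fact
  interpret Metric_space "space N" d using Xd X by simp
  interpret diffuse_Polish_measure N d
  proof
    show mcomplete using Xd X by simp
    show "separable_space mtopology" using Xd X sep by simp
    show "sets N = sigma_sets (space N) {U. openin mtopology U}" using Xd X sets by simp
    show "measure N {x} = 0" if "x \<in> space N" for x using points[OF that] by (simp add: measure_def)
    show "measure N (space N) > 0" using nz by (simp add: emeasure_eq_measure zero_less_measure_iff)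
  qed
  obtain c where "c \<in> support"
    using support_meets_open[OF openin_topspace] space_not_null by auto
  then have nc: "nice (c, 1)" by (simp add: nice_def)
  obtain h where h: "\<And>n::nat. {x \<in> space L. h x n} \<in> sets L" "inj_on h (space L)"
    using standard_Borel_separating_sequence[OF L] by blast
  show thesis
  proof (rule that)
    show "(\<Inter>n. level (c, 1) n) \<in> null_sets N" by (rule null_levels[OF nc])
    show "(\<lambda>x. branch (c, 1) (h x)) \<in> L \<rightarrow>\<^sub>M N" using h(1) by (rule measurable_branch[OF nc])
    show "inj_on (\<lambda>x. branch (c, 1) (h x)) (space L)"
      using h(2) inj_branch[OF nc] by (auto simp: inj_on_def)
    show "(\<lambda>x. branch (c, 1) (h x)) ` space L \<subseteq> (\<Inter>n. level (c, 1) n)"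
      using branch_in_level[OF nc] by auto
  qed
qed

subsection \<open>Nonsingular systems\<close>

lemma standard_Borel_singleton:
  assumes "standard_Borel M" and "x \<in> space M"
  shows "{x} \<in> sets M"
proof -
  obtain S where cm: "completely_metrizable_space S"
    and top: "topspace S = space M" and sets: "sets M = sigma_sets (space M) {U. openin S U}"
    using assms(1) by (auto simp: standard_Borel_def)
  have "closedin S {x}"
    using cm assms(2) top
    by (simp add: closedin_Hausdorff_sing_eq metrizable_imp_Hausdorff_space completely_metrizable_imp_metrizable_space)
  then have "space M - {x} \<in> sets M" by (simp add: closedin_def top sets)
  then have "space M - (space M - {x}) \<in> sets M" by (rule sets.compl_sets)
  then show ?thesis using assms(2) by (simp add: double_diff)
qed

lemma Borel_metric_mball:
  assumes "Borel_metric M d" and "x \<in> space M"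
  shows "Metric_space.mball (space M) d x e = {y \<in> space M. d x y < e}"
    and "{y \<in> space M. d x y < e} \<in> sets M"
proof -
  interpret Metric_space "space M" d using assms(1) by (simp add: Borel_metric_def)
  show "mball x e = {y \<in> space M. d x y < e}" using assms(2) by auto
  have "(\<lambda>(x, y). d x y) \<in> borel_measurable (M \<Otimes>\<^sub>M M)" using assms(1) by (simp add: Borel_metric_def)
  from measurable_compose[OF measurable_Pair1'[OF assms(2)] this]
  have "d x \<in> borel_measurable M" by simp
  then show "{y \<in> space M. d x y < e} \<in> sets M" by measurable
qed

section \<open>Null sets of a system and pulling back a Lipschitz metric\<close>

context nonsingular_system
begin

lemma emeasure_singleton: "x \<in> space M \<Longrightarrow> emeasure M {x} = 0"
proof (rule ccontr)
  assume x: "x \<in> space M" and "emeasure M {x} \<noteq> 0"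
  then obtain B where "B \<subseteq> {x}" "0 < emeasure M B" "emeasure M B < emeasure M {x}"
    using nonatomic standard_Borel_singleton[OF standard_Borel x]
    unfolding nonatomic_def by (metis not_gr_zero)
  then show False by (auto simp: subset_singleton_iff)
qed

lemma measurable_iterate: "(T ^^ n) \<in> M \<rightarrow>\<^sub>M M"
  using measurable_T by (induction n) (auto simp: measurable_comp)

lemma iterate_in_space: "x \<in> space M \<Longrightarrow> (T ^^ n) x \<in> space M"
  using measurable_iterate by (rule measurable_space)

lemma null_vimage_iterate:
  assumes "A \<in> null_sets M"
  shows "(T ^^ n) -` A \<inter> space M \<in> null_sets M"
proof (induction n)
  case 0
  have "A \<inter> space M = A" using null_setsD2[OF assms] sets.sets_into_space by blast
  then show ?case using assms by simp
next
  case (Suc n)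
  let ?B = "(T ^^ n) -` A \<inter> space M"
  have "(T ^^ Suc n) -` A \<inter> space M = T -` ?B \<inter> space M"
    using measurable_space[OF measurable_T] by (auto simp: funpow_swap1)
  moreover have "T -` ?B \<inter> space M \<in> null_sets M"
    using nonsingular[of ?B] measurable_sets[OF measurable_T, of ?B] Suc
    unfolding null_sets_def by blast
  ultimately show ?case by (simp only:)
qed

text \<open>The null Cantor set is built in a finite measure space, whereas the system is only
  \<sigma>-finite.\<close>

lemma ex_finite_positive_subset:
  assumes U: "U \<in> sets M" and pos: "emeasure M U \<noteq> 0"
  obtains A where "A \<in> sets M" "A \<subseteq> U" "emeasure M A \<noteq> 0" "emeasure M A \<noteq> \<infinity>"
proof -
  obtain F :: "nat \<Rightarrow> 'a set" where F: "range F \<subseteq> sets M" "(\<Union>i. F i) = space M" "\<And>i. emeasure M (F i) \<noteq> \<infinity>"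
    using sigma_finite by blast
  have "\<exists>i. emeasure M (U \<inter> F i) \<noteq> 0"
  proof (rule ccontr)
    assume "\<not> ?thesis"
    then have "(\<Union>i. U \<inter> F i) \<in> null_sets M"
      using U F(1) by (intro null_sets_UN) (auto simp: null_sets_def)
    moreover have "(\<Union>i. U \<inter> F i) = U" using F(2) sets.sets_into_space[OF U] by auto
    ultimately show False using pos by auto
  qed
  then obtain i where i: "emeasure M (U \<inter> F i) \<noteq> 0" ..
  have "emeasure M (U \<inter> F i) \<le> emeasure M (F i)" using F(1) by (intro emeasure_mono) auto
  then show thesis using i F U by (intro that[of "U \<inter> F i"]) (auto simp: top_unique)
qed

text \<open>
  A compatible metric has to give positive measure to the balls around every point, also around
  the points of the null set where the isomorphism is undefined. These are moved injectively into
  a null set that is removed, with all its preimages under \<open>T\<close>, from the domain of the isomorphism.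
\<close>

lemma isomorphic_Lipschitz_imp_not_sensitive:
  assumes iso: "isomorphic_mod0 M T M' T'" and comp: "compatible_metric M' d'"
    and Lip: "one_Lipschitz_wrt M' T' d'"
  shows "\<not> W_measurably_sensitive M T"
proof -
  obtain U U' \<phi> where U: "U \<in> sets M" and U': "U' \<in> sets M'"
    and null: "emeasure M (space M - U) = 0" "emeasure M' (space M' - U') = 0"
    and TU: "T ` U \<subseteq> U" and bij: "bij_betw \<phi> U U'"
    and meas_\<phi>: "\<phi> \<in> restrict_space M U \<rightarrow>\<^sub>M restrict_space M' U'"
    and distr: "distr (restrict_space M U) (restrict_space M' U') \<phi> = restrict_space M' U'"
    and equiv: "\<And>x. x \<in> U \<Longrightarrow> \<phi> (T x) = T' (\<phi> x)"
    using iso unfolding isomorphic_mod0_def by blast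
  have bm: "Borel_metric M' d'" using comp by (simp add: compatible_metric_def)
  interpret d': Metric_space "space M'" d' using bm by (simp add: Borel_metric_def)
  have US: "U \<subseteq> space M" and US': "U' \<subseteq> space M'" using U U' sets.sets_into_space by auto
  have "emeasure M U \<noteq> 0"
  proof
    assume "emeasure M U = 0"
    then have "U \<union> (space M - U) \<in> null_sets M" using U null by (intro null_sets.Un) (auto simp: null_sets_def)
    then show False using US nonzero by (auto simp: Un_absorb1)
  qed
  then obtain A where A: "A \<in> sets M" "A \<subseteq> U" "emeasure M A \<noteq> 0" "emeasure M A \<noteq> \<infinity>"
    using ex_finite_positive_subset[OF U] by blast
  have AS: "A \<subseteq> space M" using A U US by auto
  have "finite_measure (restrict_space M A)"
    using A AS by (intro finite_measureI) (simp add: emeasure_restrict_space space_restrict_space Int_absorb2)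
  moreover have "emeasure (restrict_space M A) {x} = 0" if "x \<in> space (restrict_space M A)" for x
    using that A(1) AS emeasure_singleton by (auto simp: emeasure_restrict_space space_restrict_space)
  moreover have "emeasure (restrict_space M A) (space (restrict_space M A)) \<noteq> 0"
    using A AS by (simp add: emeasure_restrict_space space_restrict_space Int_absorb2)
  ultimately obtain g K where K: "K \<in> null_sets (restrict_space M A)" and g: "g \<in> M \<rightarrow>\<^sub>M restrict_space M A"
    "inj_on g (space M)" "g ` space M \<subseteq> K"
    using ex_measurable_inj_into_null_set[OF _ standard_Borel_restrict_space[OF standard_Borel A(1)] _ _ standard_Borel]
    by metis
  have KM: "K \<in> null_sets M" using K A(1) by (simp add: null_sets_restrict_space)
  define V where "V = U - (\<Union>n. (T ^^ n) -` K \<inter> space M)"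
  have nullK: "(\<Union>n. (T ^^ n) -` K \<inter> space M) \<in> null_sets M"
    using null_vimage_iterate[OF KM] by (rule null_sets_UN)
  have V: "V \<in> sets M" "V \<subseteq> U" using U nullK by (auto simp: V_def)
  have VK: "V \<inter> K = {}"
  proof -
    have "x \<notin> V" if "x \<in> K" for x
      using that US by (auto simp: V_def intro!: exI[of _ 0])
    then show ?thesis by blast
  qed
  have TV: "T x \<in> V" if "x \<in> V" for x
  proof -
    have x: "x \<in> U" "x \<in> space M" using that V US by auto
    have "(T ^^ n) (T x) \<notin> K" for n
      using that x unfolding V_def by (auto simp: funpow_swap1 dest: spec[of _ "Suc n"])
    then show ?thesis using TU x by (auto simp: V_def)
  qed
  have TnV: "(T ^^ n) x \<in> V" if "x \<in> V" for n x
    using TV that by (induction n) auto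
  \<comment> \<open>\<open>\<rho>\<close> maps all of \<open>space M\<close> into \<open>U\<close>,
    where \<open>\<phi>\<close> is defined. It stays injective because \<open>g\<close> takes values
    in \<open>K\<close>, which \<open>V\<close> avoids. It need not commute with \<open>T\<close>
    off \<open>V\<close>.\<close>
  define \<rho> where "\<rho> x = (if x \<in> V then x else g x)" for x
  have "g \<in> M \<rightarrow>\<^sub>M M" using g(1) by (simp add: measurable_restrict_space2_iff)
  then have "\<rho> \<in> M \<rightarrow>\<^sub>M M"
    unfolding \<rho>_def using V(1) by (intro measurable_If_set) auto
  moreover have gA: "g x \<in> A" if "x \<in> space M" for x
    using measurable_space[OF g(1) that] AS by (simp add: space_restrict_space)
  ultimately have meas_\<rho>: "\<rho> \<in> M \<rightarrow>\<^sub>M restrict_space M U"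
    using subsetD[OF V(2)] subsetD[OF A(2)]
    by (intro measurable_restrict_space2) (auto simp: \<rho>_def)
  have \<rho>U: "\<rho> x \<in> U" if "x \<in> space M" for x
    using measurable_space[OF meas_\<rho> that] US by (simp add: space_restrict_space)
  have inj_\<rho>: "x = y" if "x \<in> space M" "y \<in> space M" "\<rho> x = \<rho> y" for x y
  proof -
    have "g x \<in> K" "g y \<in> K" using g(3) that by auto
    then show ?thesis using that VK g(2) by (auto simp: \<rho>_def inj_on_def split: if_splits)
  qed
  define \<psi> where "\<psi> x = \<phi> (\<rho> x)" for x
  have "\<psi> \<in> M \<rightarrow>\<^sub>M restrict_space M' U'"
    unfolding \<psi>_def using measurable_compose[OF meas_\<rho> meas_\<phi>] .
  then have meas_\<psi>: "\<psi> \<in> M \<rightarrow>\<^sub>M M'" by (simp add: measurable_restrict_space2_iff)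
  have \<psi>S: "\<psi> x \<in> space M'" if "x \<in> space M" for x using measurable_space[OF meas_\<psi> that] .
  have inj_\<psi>: "x = y" if "x \<in> space M" "y \<in> space M" "\<psi> x = \<psi> y" for x y
    using that bij \<rho>U inj_\<rho> by (auto simp: \<psi>_def bij_betw_def inj_on_def)
  have \<psi>V: "\<psi> x = \<phi> x" if "x \<in> V" for x using that by (simp add: \<psi>_def \<rho>_def)
  define d where "d x y = d' (\<psi> x) (\<psi> y)" for x y
  have metric: "Metric_space (space M) d"
  proof
    show "0 \<le> d x y" "d x y = d y x" for x y by (auto simp: d_def d'.commute)
    show "(d x y = 0) = (x = y)" if "x \<in> space M" "y \<in> space M" for x y
      using that \<psi>S inj_\<psi> by (auto simp: d_def)
    show "d x z \<le> d x y + d y z" if "x \<in> space M" "y \<in> space M" "z \<in> space M" for x y z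
      using that \<psi>S by (auto simp: d_def intro!: d'.triangle)
  qed
  have "(\<lambda>p. (\<psi> (fst p), \<psi> (snd p))) \<in> M \<Otimes>\<^sub>M M \<rightarrow>\<^sub>M M' \<Otimes>\<^sub>M M'"
    using meas_\<psi> by measurable
  moreover have "(\<lambda>(x, y). d' x y) \<in> borel_measurable (M' \<Otimes>\<^sub>M M')"
    using bm by (simp add: Borel_metric_def)
  ultimately have "(\<lambda>p. case (\<psi> (fst p), \<psi> (snd p)) of (x, y) \<Rightarrow> d' x y) \<in> borel_measurable (M \<Otimes>\<^sub>M M)"
    by (rule measurable_compose)
  then have "(\<lambda>(x, y). d x y) \<in> borel_measurable (M \<Otimes>\<^sub>M M)"
    by (simp add: d_def case_prod_beta)
  then have bmd: "Borel_metric M d"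
    using metric bm \<psi>S by (auto simp: Borel_metric_def d_def)
  \<comment> \<open>The centre \<open>x\<close> is any point of \<open>space M'\<close>, so this
    covers points of \<open>V\<close> and relocated points alike. The pulled-back ball keeps its
    measure under \<open>\<phi>\<close>, and passing from \<open>U\<close> to \<open>V\<close>
    removes only a null set.\<close>
  have ball_sets: "{y \<in> V. d' x (\<phi> y) < e} \<in> sets M"
    and ball_pos: "0 < emeasure M {y \<in> V. d' x (\<phi> y) < e}"
    if x: "x \<in> space M'" and e: "e > 0" for x e
  proof -
    let ?B = "{y \<in> space M'. d' x y < e}"
    have "0 < emeasure M' (d'.mball x e)" using comp x e by (simp add: compatible_metric_def)
    then have B: "?B \<in> sets M'" "0 < emeasure M' ?B"
      unfolding Borel_metric_mball(1)[OF bm x] using Borel_metric_mball(2)[OF bm x] by blast+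
    have BU: "?B \<inter> U' \<in> sets (restrict_space M' U')" using B U' by (simp add: sets_restrict_space_iff)
    have pre: "\<phi> -` (?B \<inter> U') \<inter> space (restrict_space M U) = {y \<in> U. d' x (\<phi> y) < e}"
      using bij US US' by (auto simp: space_restrict_space bij_betw_def)
    have preM: "{y \<in> U. d' x (\<phi> y) < e} \<in> sets M"
      using measurable_sets[OF meas_\<phi> BU] U US unfolding pre by (simp add: sets_restrict_space_iff Int_absorb2)
    have "emeasure M' ?B = emeasure M' (?B - (space M' - U'))"
      using B U' null by (intro emeasure_Diff_null_set[symmetric]) (auto simp: null_sets_def)
    also have "?B - (space M' - U') = ?B \<inter> U'" by auto
    also have "emeasure M' (?B \<inter> U') = emeasure (restrict_space M' U') (?B \<inter> U')"
      using U' by (simp add: emeasure_restrict_space)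
    also have "\<dots> = emeasure (restrict_space M U) {y \<in> U. d' x (\<phi> y) < e}"
      using emeasure_distr[OF meas_\<phi> BU] unfolding distr pre .
    also have "\<dots> = emeasure M {y \<in> U. d' x (\<phi> y) < e}"
      using U by (auto simp: emeasure_restrict_space)
    also have "\<dots> = emeasure M ({y \<in> U. d' x (\<phi> y) < e} - (\<Union>n. (T ^^ n) -` K \<inter> space M))"
      by (intro emeasure_Diff_null_set[symmetric] nullK preM)
    also have "{y \<in> U. d' x (\<phi> y) < e} - (\<Union>n. (T ^^ n) -` K \<inter> space M) = {y \<in> V. d' x (\<phi> y) < e}"
      by (auto simp: V_def)
    finally show "0 < emeasure M {y \<in> V. d' x (\<phi> y) < e}" using B by simp
    have "{y \<in> V. d' x (\<phi> y) < e} = {y \<in> U. d' x (\<phi> y) < e} \<inter> V" using V by auto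
    then show "{y \<in> V. d' x (\<phi> y) < e} \<in> sets M" using preM V(1) by auto
  qed
  have "compatible_metric M d"
    unfolding compatible_metric_def
  proof (intro conjI ballI allI impI bmd)
    fix x and e :: real assume x: "x \<in> space M" and e: "e > 0"
    have "{y \<in> V. d' (\<psi> x) (\<phi> y) < e} \<subseteq> {y \<in> space M. d x y < e}"
      using \<psi>V V US by (auto simp: d_def)
    then have "emeasure M {y \<in> V. d' (\<psi> x) (\<phi> y) < e} \<le> emeasure M {y \<in> space M. d x y < e}"
      by (intro emeasure_mono Borel_metric_mball[OF bmd x])
    then show "0 < emeasure M (Metric_space.mball (space M) d x e)"
      unfolding Borel_metric_mball(1)[OF bmd x] using ball_pos[OF \<psi>S[OF x] e] by simp
  qed
  moreover have "\<not> W_sensitive_wrt M T d"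
  proof
    assume "W_sensitive_wrt M T d"
    then obtain \<delta> where \<delta>: "\<delta> > 0" and sens: "\<And>x. x \<in> space M \<Longrightarrow> AE y in M.
        limsup (\<lambda>n. ereal (d ((T ^^ n) x) ((T ^^ n) y))) > ereal \<delta>"
      unfolding W_sensitive_wrt_def by blast
    have "space M \<noteq> {}" using nonzero by auto
    then obtain x0 where "x0 \<in> space M" by auto
    \<comment> \<open>This supplies a point of \<open>V\<close>, whose orbit stays where
      \<open>\<phi>\<close> intertwines the two maps; the radius 1 is arbitrary.\<close>
    then have "0 < emeasure M {y \<in> V. d' (\<psi> x0) (\<phi> y) < 1}" using ball_pos[OF \<psi>S[of x0], of 1] by simp
    then have "{y \<in> V. d' (\<psi> x0) (\<phi> y) < 1} \<noteq> {}" by (metis emeasure_empty less_irrefl)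
    then obtain x where x: "x \<in> V" by auto
    then have xS: "x \<in> space M" using V US by auto
    let ?B = "{y \<in> V. d' (\<psi> x) (\<phi> y) < \<delta>}"
    \<comment> \<open>Along orbits in \<open>V\<close> the distance never increases, so every
      \<open>y\<close> in the positive-measure set \<open>?B\<close> violates the strict inequality
      of sensitivity.\<close>
    have small: "limsup (\<lambda>n. ereal (d ((T ^^ n) x) ((T ^^ n) y))) \<le> ereal \<delta>" if y: "y \<in> ?B" for y
    proof -
      have yV: "y \<in> V" using y by simp
      have "d ((T ^^ n) x) ((T ^^ n) y) \<le> \<delta>" for n
      proof (induction n)
        case 0
        then show ?case using y x by (simp add: d_def \<psi>V)
      next
        case (Suc n)
        have in_V: "(T ^^ n) x \<in> V" "(T ^^ n) y \<in> V" using x yV TnV by auto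
        then have in_S: "\<phi> ((T ^^ n) x) \<in> space M'" "\<phi> ((T ^^ n) y) \<in> space M'"
          using bij V US' by (auto simp: bij_betw_def)
        have "d ((T ^^ Suc n) x) ((T ^^ Suc n) y) = d' (T' (\<phi> ((T ^^ n) x))) (T' (\<phi> ((T ^^ n) y)))"
          using in_V TV V equiv by (simp add: d_def \<psi>V subset_iff)
        also have "\<dots> \<le> d' (\<phi> ((T ^^ n) x)) (\<phi> ((T ^^ n) y))"
          using Lip in_S by (simp add: one_Lipschitz_wrt_def)
        also have "\<dots> = d ((T ^^ n) x) ((T ^^ n) y)" using in_V by (simp add: d_def \<psi>V)
        finally show ?case using Suc by simp
      qed
      then show ?thesis by (intro Limsup_bounded) auto
    qed
    have "AE y in M. y \<notin> ?B" using sens[OF xS] by eventually_elim (use small in force)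
    then have "emeasure M ?B = 0"
      using ball_sets[OF \<psi>S[OF xS] \<delta>] V US
      by (subst (asm) AE_iff_measurable[of ?B]) auto
    then show False using ball_pos[OF \<psi>S[OF xS] \<delta>] by simp
  qed
  ultimately show ?thesis unfolding W_measurably_sensitive_def by blast
qed

section \<open>From failure of sensitivity to a Lipschitz system\<close>

text \<open>The identity on \<open>G\<close> is the isomorphism. Nonsingularity survives because the
  preimage of a set within \<open>G\<close> differs from its full preimage by a null set.\<close>

lemma restrict_conull_invariant:
  assumes G: "G \<in> sets M" and conull: "emeasure M (space M - G) = 0" and TG: "T ` G \<subseteq> G"
  shows "nonsingular_system (restrict_space M G) T" and "isomorphic_mod0 M T (restrict_space M G) T"
proof -
  let ?N = "restrict_space M G"
  have GS: "G \<subseteq> space M" using G sets.sets_into_space by auto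
  have sp: "space ?N = G" using GS by (auto simp: space_restrict_space)
  have sN: "A \<in> sets ?N \<longleftrightarrow> A \<subseteq> G \<and> A \<in> sets M" for A
    using G by (simp add: sets_restrict_space_iff)
  have em: "A \<subseteq> G \<Longrightarrow> emeasure ?N A = emeasure M A" for A
    using G by (simp add: emeasure_restrict_space)
  have nullG: "space M - G \<in> null_sets M" using G conull by auto
  have meas_T: "T \<in> ?N \<rightarrow>\<^sub>M ?N"
    using measurable_T TG by (intro measurable_restrict_space3) auto
  interpret N: sigma_finite_measure ?N
    using sigma_finite_measure_axioms G by (rule sigma_finite_measure_restrict_space)
  show "nonsingular_system ?N T"
  proof
    show "standard_Borel ?N" using standard_Borel G by (rule standard_Borel_restrict_space)
    have "space M - (space M - G) = G" using GS by auto
    then have "emeasure M G = emeasure M (space M)"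
      using emeasure_Diff_null_set[OF nullG sets.top] by simp
    then show "emeasure ?N (space ?N) \<noteq> 0" using nonzero em[of G] sp by simp
    show "nonatomic ?N"
      unfolding nonatomic_def
    proof (intro ballI impI)
      fix A assume A: "A \<in> sets ?N" "0 < emeasure ?N A"
      then obtain B where "B \<in> sets M" "B \<subseteq> A" "0 < emeasure M B" "emeasure M B < emeasure M A"
        using nonatomic sN em unfolding nonatomic_def by metis
      then show "\<exists>B\<in>sets ?N. B \<subseteq> A \<and> 0 < emeasure ?N B \<and> emeasure ?N B < emeasure ?N A"
        using A sN em by (intro bexI[of _ B]) auto
    qed
    show "T \<in> ?N \<rightarrow>\<^sub>M ?N" by (rule meas_T)
    fix A assume A: "A \<in> sets ?N"
    have "T -` A \<inter> space ?N = (T -` A \<inter> space M) - (space M - G)" using sp GS by auto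
    moreover have "emeasure M ((T -` A \<inter> space M) - (space M - G)) = emeasure M (T -` A \<inter> space M)"
      using A sN measurable_sets[OF measurable_T] by (intro emeasure_Diff_null_set nullG) auto
    ultimately have "emeasure ?N (T -` A \<inter> space ?N) = emeasure M (T -` A \<inter> space M)"
      using em[of "T -` A \<inter> space ?N"] sp by (metis inf_le2)
    then show "emeasure ?N A = 0 \<longleftrightarrow> emeasure ?N (T -` A \<inter> space ?N) = 0"
      using nonsingular[of A] A sN em by simp
  qed
  have rr: "restrict_space ?N G = ?N" using G GS by (simp add: restrict_restrict_space)
  have inv: "inv_into G (\<lambda>x. x) \<in> ?N \<rightarrow>\<^sub>M ?N"
  proof (subst measurable_cong)
    show "inv_into G (\<lambda>x. x) x = x" if "x \<in> space ?N" for x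
      using that sp inv_into_f_f[of "\<lambda>x. x" G x] by (simp add: inj_on_def)
  qed simp
  show "isomorphic_mod0 M T ?N T"
    unfolding isomorphic_mod0_def
  proof (rule bexI[OF _ G], rule bexI[of _ G], rule exI[of _ "\<lambda>x. x"], unfold rr, intro conjI ballI)
    show "G \<in> sets ?N" using sN G by simp
  qed (use conull TG sp inv in \<open>auto simp: distr_id2 bij_betw_def\<close>)
qed


lemma not_sensitive_imp_isomorphic_Lipschitz:
  assumes ce: "conservative_ergodic M T" and comp: "compatible_metric M d"
    and not_sens: "\<not> W_sensitive_wrt M T d"
  shows "has_isomorphic_Lipschitz_system TYPE('a) M T"
proof -
  have bm: "Borel_metric M d" using comp by (simp add: compatible_metric_def)
  interpret Metric_space "space M" d using bm by (simp add: Borel_metric_def)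
  have d_le1: "d x y \<le> 1" if "x \<in> space M" "y \<in> space M" for x y
    using bm that by (simp add: Borel_metric_def)
  have d_meas: "(\<lambda>(x, y). d x y) \<in> borel_measurable (M \<Otimes>\<^sub>M M)"
    using bm by (simp add: Borel_metric_def)
  have TS: "T x \<in> space M" if "x \<in> space M" for x
    using measurable_space[OF measurable_T that] .
  \<comment> \<open>The value 0 off the carrier provides the nonnegativity and symmetry that
    \<open>Metric_space\<close> demands there; boundedness of the supremum is known only on the
    carrier.\<close>
  define D where "D x y = (if x \<in> space M \<and> y \<in> space M
    then SUP n. d ((T ^^ n) x) ((T ^^ n) y) else 0)" for x y
  have bdd: "bdd_above (range (\<lambda>n. d ((T ^^ n) x) ((T ^^ n) y)))"
    if "x \<in> space M" "y \<in> space M" for x y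
    using that d_le1 iterate_in_space by (intro bdd_aboveI2[of _ _ 1]) auto
  have D_ge: "d ((T ^^ n) x) ((T ^^ n) y) \<le> D x y" if "x \<in> space M" "y \<in> space M" for x y n
    using that bdd[OF that] by (auto simp: D_def intro!: cSUP_upper)
  have D_le: "D x y \<le> c" if "x \<in> space M" "y \<in> space M"
    "\<And>n. d ((T ^^ n) x) ((T ^^ n) y) \<le> c" for x y c
    using that by (auto simp: D_def intro!: cSUP_least)
  have D_metric: "Metric_space (space M) D"
  proof
    show "0 \<le> D x y" for x y
    proof (cases "x \<in> space M \<and> y \<in> space M")
      case True
      then show ?thesis using order_trans[OF nonneg D_ge[of x y 0]] by simp
    next
      case False
      then show ?thesis by (auto simp: D_def)
    qed
    show "D x y = D y x" for x y by (simp add: D_def commute)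
    show "(D x y = 0) = (x = y)" if "x \<in> space M" "y \<in> space M" for x y
    proof
      assume "D x y = 0"
      then have "d x y = 0" using D_ge[OF that, of 0] by (simp add: antisym)
      then show "x = y" using that by simp
    next
      assume "x = y"
      then show "D x y = 0" using that iterate_in_space by (simp add: D_def)
    qed
    show "D x z \<le> D x y + D y z" if xyz: "x \<in> space M" "y \<in> space M" "z \<in> space M" for x y z
    proof (rule D_le)
      fix n
      have "d ((T ^^ n) x) ((T ^^ n) z) \<le> d ((T ^^ n) x) ((T ^^ n) y) + d ((T ^^ n) y) ((T ^^ n) z)"
        using xyz iterate_in_space by (intro triangle)
      then show "d ((T ^^ n) x) ((T ^^ n) z) \<le> D x y + D y z"
        using D_ge[of x y n] D_ge[of y z n] xyz by linarith
    qed (use xyz in auto)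
  qed
  have D_meas: "(\<lambda>(x, y). D x y) \<in> borel_measurable (M \<Otimes>\<^sub>M M)"
  proof -
    have "(\<lambda>p. SUP n. d ((T ^^ n) (fst p)) ((T ^^ n) (snd p))) \<in> borel_measurable (M \<Otimes>\<^sub>M M)"
    proof (rule borel_measurable_cSUP)
      fix n :: nat
      have "(\<lambda>p. ((T ^^ n) (fst p), (T ^^ n) (snd p))) \<in> M \<Otimes>\<^sub>M M \<rightarrow>\<^sub>M M \<Otimes>\<^sub>M M"
        using measurable_iterate[of n] by measurable
      from measurable_compose[OF this d_meas]
      show "(\<lambda>p. d ((T ^^ n) (fst p)) ((T ^^ n) (snd p))) \<in> borel_measurable (M \<Otimes>\<^sub>M M)" by simp
    next
      fix p assume "p \<in> space (M \<Otimes>\<^sub>M M)"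
      then show "bdd_above (range (\<lambda>n. d ((T ^^ n) (fst p)) ((T ^^ n) (snd p))))"
        by (intro bdd) (auto simp: space_pair_measure)
    qed simp
    then show ?thesis
      by (rule measurable_cong[THEN iffD1, rotated]) (auto simp: D_def space_pair_measure)
  qed
  have "D x y \<le> 1" if "x \<in> space M" "y \<in> space M" for x y
    using that d_le1 iterate_in_space by (intro D_le) auto
  then have bmD: "Borel_metric M D" using D_metric D_meas by (simp add: Borel_metric_def)
  have Lip: "D (T x) (T y) \<le> D x y" if "x \<in> space M" "y \<in> space M" for x y
  proof (rule D_le)
    show "d ((T ^^ n) (T x)) ((T ^^ n) (T y)) \<le> D x y" for n
      using D_ge[OF that, of "Suc n"] by (simp add: funpow_swap1)
  qed (use that TS in auto)
  define B where "B x e = {y \<in> space M. D x y < e}" for x e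
  have B_sets: "B x e \<in> sets M" if "x \<in> space M" for x e
    unfolding B_def by (rule Borel_metric_mball(2)[OF bmD that])
  define H where "H e = {x \<in> space M. 0 < emeasure M (B x e)}" for e
  have H_sets: "H e \<in> sets M" for e
  proof -
    \<comment> \<open>The balls are the sections of a measurable set in the product, and the measure
      of sections depends measurably on the base point.\<close>
    let ?Q = "{p \<in> space (M \<Otimes>\<^sub>M M). (case p of (x, y) \<Rightarrow> D x y) < e}"
    have "?Q \<in> sets (M \<Otimes>\<^sub>M M)" using D_meas by measurable
    then have "(\<lambda>x. emeasure M (Pair x -` ?Q)) \<in> borel_measurable M"
      by (rule measurable_emeasure_Pair)
    then have "{x \<in> space M. 0 < emeasure M (Pair x -` ?Q)} \<in> sets M" by measurable
    also have "{x \<in> space M. 0 < emeasure M (Pair x -` ?Q)} = H e"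
      unfolding H_def B_def
      by (intro Collect_cong conj_cong refl arg_cong[of _ _ "\<lambda>A. 0 < emeasure M A"])
        (auto simp: space_pair_measure)
    finally show ?thesis .
  qed
  \<comment> \<open>The preimage of the ball around \<open>T x\<close> contains the ball around
    \<open>x\<close>, so by nonsingularity a null ball around \<open>T x\<close> would force a null
    ball around \<open>x\<close>.\<close>
  have T_H: "T x \<in> H e" if "x \<in> H e" for x e
  proof -
    have x: "x \<in> space M" "0 < emeasure M (B x e)" using that by (auto simp: H_def)
    have "B x e \<subseteq> T -` B (T x) e \<inter> space M"
      using Lip x TS by (auto simp: B_def intro: le_less_trans)
    then have "emeasure M (B x e) \<le> emeasure M (T -` B (T x) e \<inter> space M)"
      using measurable_sets[OF measurable_T B_sets[OF TS[OF x(1)]]] by (rule emeasure_mono)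
    then have "emeasure M (B (T x) e) \<noteq> 0"
      using x(2) nonsingular[OF B_sets[OF TS[OF x(1)]], of e] by auto
    then show ?thesis using TS x by (simp add: H_def zero_less_iff_neq_zero)
  qed
  \<comment> \<open>If all \<open>D\<close>-balls of radius \<open>e\<close> were null, almost no
    \<open>y\<close> would ever enter such a ball around the orbit of \<open>x\<close> at the same
    time. But a limsup of at most \<open>e / 3\<close> puts a tail below \<open>e / 2\<close>, so
    the supremum from time \<open>m\<close> on is at most \<open>e / 2 < e\<close>.\<close>
  have H_ne: "H e \<noteq> {}" if e: "e > 0" for e
  proof
    assume empty: "H e = {}"
    obtain x where x: "x \<in> space M"
      and nAE: "\<not> (AE y in M. limsup (\<lambda>n. ereal (d ((T ^^ n) x) ((T ^^ n) y))) > ereal (e / 3))"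
      using not_sens e unfolding W_sensitive_wrt_def by (meson divide_pos_pos zero_less_numeral)
    have "B ((T ^^ n) x) e \<in> null_sets M" for n
      using empty iterate_in_space[OF x] B_sets by (auto simp: H_def null_sets_def)
    then have "(\<Union>n. (T ^^ n) -` B ((T ^^ n) x) e \<inter> space M) \<in> null_sets M"
      using null_vimage_iterate by (intro null_sets_UN) blast
    then have "AE y in M. limsup (\<lambda>n. ereal (d ((T ^^ n) x) ((T ^^ n) y))) > ereal (e / 3)"
    proof (rule AE_I', intro subsetI)
      fix y assume "y \<in> {y \<in> space M. \<not> limsup (\<lambda>n. ereal (d ((T ^^ n) x) ((T ^^ n) y))) > ereal (e / 3)}"
      then have y: "y \<in> space M"
        and "limsup (\<lambda>n. ereal (d ((T ^^ n) x) ((T ^^ n) y))) \<le> ereal (e / 3)" by auto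
      then have "limsup (\<lambda>n. ereal (d ((T ^^ n) x) ((T ^^ n) y))) < ereal (e / 2)"
        using e by (elim le_less_trans) simp
      then have "\<forall>\<^sub>F n in sequentially. ereal (d ((T ^^ n) x) ((T ^^ n) y)) < ereal (e / 2)"
        by (rule Limsup_lessD)
      then obtain m where m: "\<And>n. n \<ge> m \<Longrightarrow> d ((T ^^ n) x) ((T ^^ n) y) < e / 2"
        by (auto simp: eventually_sequentially)
      have "D ((T ^^ m) x) ((T ^^ m) y) \<le> e / 2"
      proof (rule D_le)
        show "d ((T ^^ n) ((T ^^ m) x)) ((T ^^ n) ((T ^^ m) y)) \<le> e / 2" for n
          using m[of "n + m"] by (simp add: funpow_add)
      qed (use x y iterate_in_space in auto)
      then have "(T ^^ m) y \<in> B ((T ^^ m) x) e" using e y iterate_in_space by (auto simp: B_def)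
      then show "y \<in> (\<Union>n. (T ^^ n) -` B ((T ^^ n) x) e \<inter> space M)" using y by blast
    qed
    with nAE show False by contradiction
  qed
  have H_conull: "space M - H e \<in> null_sets M" if e: "e > 0" for e
  proof -
    obtain x where "x \<in> H (e / 2)" using H_ne[of "e / 2"] e by auto
    then have x: "x \<in> space M" "0 < emeasure M (B x (e / 2))" by (auto simp: H_def)
    \<comment> \<open>Halving the radius lets one ball of positive measure fit into the
      \<open>e\<close>-balls around all of its own points, so that \<open>H e\<close> has positive
      measure rather than being merely nonempty.\<close>
    have "B x (e / 2) \<subseteq> H e"
    proof
      fix y assume y: "y \<in> B x (e / 2)"
      then have yS: "y \<in> space M" by (simp add: B_def)
      have "B x (e / 2) \<subseteq> B y e"
      proof
        fix z assume z: "z \<in> B x (e / 2)"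
        have "D y z \<le> D y x + D x z"
          using x yS z by (intro Metric_space.triangle[OF D_metric]) (auto simp: B_def)
        also have "D y x = D x y" by (rule Metric_space.commute[OF D_metric])
        finally show "z \<in> B y e" using y z by (auto simp: B_def)
      qed
      then have "emeasure M (B x (e / 2)) \<le> emeasure M (B y e)" using B_sets[OF yS] by (rule emeasure_mono)
      then show "y \<in> H e" using x yS by (auto simp: H_def)
    qed
    then have "emeasure M (B x (e / 2)) \<le> emeasure M (H e)" using H_sets by (rule emeasure_mono)
    then have pos: "emeasure M (H e) \<noteq> 0" using x by auto
    have sub: "H e \<subseteq> space M" by (auto simp: H_def)
    \<comment> \<open>Ergodicity is stated for sets containing their preimage, hence it is applied
      to the complement of the forward invariant set \<open>H e\<close>.\<close>
    have "T -` (space M - H e) \<inter> space M \<subseteq> space M - H e" using T_H by auto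
    then have "emeasure M (space M - H e) = 0 \<or> emeasure M (space M - (space M - H e)) = 0"
      using ce H_sets unfolding conservative_ergodic_def by blast
    then show ?thesis using pos sub H_sets by (auto simp: double_diff)
  qed
  define G where "G = (\<Inter>k. H (1 / real (Suc k)))"
  have G: "G \<in> sets M" unfolding G_def using H_sets by auto
  have GS: "G \<subseteq> space M" using sets.sets_into_space[OF G] .
  have "space M - G = (\<Union>k. space M - H (1 / real (Suc k)))" by (auto simp: G_def)
  moreover have "(\<Union>k. space M - H (1 / real (Suc k))) \<in> null_sets M"
    by (intro null_sets_UN H_conull) simp
  ultimately have nullG: "space M - G \<in> null_sets M" by simp
  have TG: "T ` G \<subseteq> G" using T_H by (auto simp: G_def)
  have conull: "emeasure M (space M - G) = 0" using nullG by auto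
  let ?N = "restrict_space M G"
  have sp: "space ?N = G" using GS by (auto simp: space_restrict_space)
  have "Metric_space G D" using Metric_space.subspace[OF D_metric GS] .
  moreover have "(\<lambda>(x, y). D x y) \<in> borel_measurable (?N \<Otimes>\<^sub>M ?N)"
  proof -
    have "(\<lambda>x. x) \<in> ?N \<rightarrow>\<^sub>M M" by (rule measurable_restrict_space1) simp
    then have "(\<lambda>p. (fst p, snd p)) \<in> ?N \<Otimes>\<^sub>M ?N \<rightarrow>\<^sub>M M \<Otimes>\<^sub>M M"
      by (intro measurable_Pair measurable_compose[OF measurable_fst] measurable_compose[OF measurable_snd])
    from measurable_compose[OF this D_meas] show ?thesis by (simp add: case_prod_beta)
  qed
  ultimately have bmN: "Borel_metric ?N D"
    using bmD GS by (auto simp: Borel_metric_def sp)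
  have "compatible_metric ?N D"
    unfolding compatible_metric_def
  proof (intro conjI ballI allI impI bmN)
    fix x and e :: real assume x: "x \<in> space ?N" and e: "e > 0"
    then obtain k where k: "1 / real (Suc k) < e"
      using reals_Archimedean[of e] by (auto simp: inverse_eq_divide)
    have xG: "x \<in> G" "x \<in> space M" using x sp GS by auto
    then have "x \<in> H (1 / real (Suc k))" by (auto simp: G_def)
    then have "0 < emeasure M (B x (1 / real (Suc k)))" by (simp add: H_def)
    also have "\<dots> \<le> emeasure M (B x e)"
      using k B_sets[OF xG(2)] by (intro emeasure_mono) (auto simp: B_def)
    also have "\<dots> = emeasure M (B x e - (space M - G))"
      by (rule emeasure_Diff_null_set[symmetric, OF nullG B_sets[OF xG(2)]])
    also have "B x e - (space M - G) = {y \<in> space ?N. D x y < e}"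
      using GS by (auto simp: B_def sp)
    also have "emeasure M \<dots> = emeasure ?N {y \<in> space ?N. D x y < e}"
      using G GS by (subst emeasure_restrict_space) (auto simp: sp)
    finally show "0 < emeasure ?N (Metric_space.mball (space ?N) D x e)"
      unfolding Borel_metric_mball(1)[OF bmN x] .
  qed
  moreover have "one_Lipschitz_wrt ?N T D"
    using Lip GS by (auto simp: one_Lipschitz_wrt_def sp)
  ultimately show ?thesis
    unfolding has_isomorphic_Lipschitz_system_def
    using restrict_conull_invariant[OF G conull TG] by blast
qed

end

theorem proposition6p3:
  fixes M :: "'a measure" and T :: "'a \<Rightarrow> 'a"
  assumes "nonsingular_system M T" and "conservative_ergodic M T"
  shows "W_measurably_sensitive M T \<longleftrightarrow>
    \<not> has_isomorphic_Lipschitz_system TYPE('a) M T \<and>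
    \<not> has_isomorphic_Lipschitz_system TYPE('b) M T"
proof -
  interpret nonsingular_system M T by fact
  show ?thesis
  proof
    assume "W_measurably_sensitive M T"
    then show "\<not> has_isomorphic_Lipschitz_system TYPE('a) M T \<and>
        \<not> has_isomorphic_Lipschitz_system TYPE('b) M T"
      using isomorphic_Lipschitz_imp_not_sensitive
      unfolding has_isomorphic_Lipschitz_system_def by metis
  next
    assume "\<not> has_isomorphic_Lipschitz_system TYPE('a) M T \<and>
        \<not> has_isomorphic_Lipschitz_system TYPE('b) M T"
    then show "W_measurably_sensitive M T"
      \<comment> \<open>The system constructed here is a restriction of \<open>M\<close>, so it
        lives on the type \<open>'a\<close>; the opposite direction applies to systems on any
        type.\<close>
      using not_sensitive_imp_isomorphic_Lipschitz[OF assms(2)]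
      unfolding W_measurably_sensitive_def by blast
  qed
qed

end
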